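(* Let $n\ge1$ and $\mathbf i\in\Sigma_{n+1}$. Suppose there exists $(\sigma_1,\dots,\sigma_n)\in\{A,D\}^n$ such that $\mathrm{ind}_{\sigma_k}\big(C_{\sigma_{k+1}}\circ\cdots\circ C_{\sigma_n}(\mathbf i)\big)=0$ for all $k=n,\dots,1$. Then for every dominant integral weight $\lambda$, the string polytope $\Delta_{\mathbf i}(\lambda)$ is unimodularly equivalent to the Gelfand–Cetlin polytope $GC(\lambda)$.
   Context: $N=n(n+1)/2$; $\Sigma_{n+1}$: reduced words $\mathbf i=(i_1,\dots,i_N)$ of the longest element of $\mathfrak S_{n+1}$ in $s_i=(i,i+1)$. Wiring diagram $G(\mathbf i)$: $n+1$ wires $\ell_1,\dots,\ell_{n+1}$ run top to bottom through positions $1,\dots,n+1$; at the top $\ell_k$ is in position $k$; the $j$-th node $t_j$ swaps the wires in positions $i_j,i_j+1$; at the bottom $\ell_k$ is in position $n+2-k$ and ends at $L_k$. $t_j$ also denotes the $j$-th coordinate of $\mathbb R^N$. Rigorous paths: for $k\in[n]$, $G(\mathbf i,k)$ has $\ell_1,\dots,\ell_k$ oriented upward, the rest downward. A rigorous path in $G(\mathbf i,k)$ starts at $L_k$, ends at $L_{k+1}$, moves along wires in their orientation, switches wires only at their crossing node, passes each node at most once, and never passes straight through $\ell_a\cap\ell_b$ while on $\ell_a$ when both are downward with $a>b$ or both upward with $a<b$. String inequality of $P$: $\sum_ja_jt_j\ge0$ with $a_j=1$ (resp. $-1$) if $P$ switches at $t_j$ from $\ell_r$ to $\ell_s$ with $r<s$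 (resp. $r>s$), else $0$. $\lambda=\sum\lambda_i\varpi_i$ ($\varpi_i$ fundamental weights) is dominant integral if all $\lambda_i\in\mathbb Z_{\ge0}$. $\lambda$-inequality of $t_j$: $t_j\le\lambda_{i_j}+\sum_{k>j}a_kt_k$ with $a_k=1$ if $|i_k-i_j|=1$, $-2$ if $i_k=i_j$, $0$ otherwise. $\Delta_{\mathbf i}(\lambda)$: points of $\mathbb R^N$ satisfying all string and all $\lambda$-inequalities. $GC(\lambda)\subset\mathbb R^N$ (coordinates $x_{k,j}$, $1\le j\le k\le n$): $x_{k+1,j}\ge x_{k,j}\ge x_{k+1,j+1}$ for all $1\le j\le k\le n$, where $x_{n+1,j}=\lambda_j+\cdots+\lambda_n$, $x_{n+1,n+1}=0$. Unimodular equivalence: an affine map $x\mapsto Mx+v$, $M\in GL_N(\mathbb Z)$, $v\in\mathbb Z^N$, mapping one onto the other. Indices/contractions: 2-moves exchange adjacent letters $i,j$ with $|i-j|>1$, generating $\sim$. Every $\mathbf i$ satisfies $\mathbf i\sim\mathbf i_D^-(n,\dots,1)\mathbf i_D^+\sim\mathbf i_A^-(1,\dots,n)\mathbf i_A^+$; $\mathrm{ind}_D(\mathbf i)=|\mathbf i_D^+|$, $\mathrm{ind}_A(\mathbf i)=|\mathbf i_A^+|$; $C_D(\mathbf i)=\mathbf i_D^-(\mathbf i_D^+-1)\in\Sigma_n$, $C_A(\mathbf i)=(\mathbf i_A^--1)\mathbf i_A^+\in\Sigma_n$ ($\mathbf w\pm1$ adds $\pm1$ to each letter; well defined up to $\sim$;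 indices are invariant under $\sim$). *)

theory Defs
  imports Main "HOL.Real"
begin

definition Nn :: "nat \<Rightarrow> nat" where
  "Nn n = n * (n + 1) div 2"

definition sw :: "nat \<Rightarrow> nat \<Rightarrow> nat" where
  "sw a p = (if p = a then Suc a else if p = Suc a then a else p)"

text \<open>Product s_(w_1) ... s_(w_m), as a map position -> wire (wiring-diagram arrangement).\<close>
definition word_perm :: "nat list \<Rightarrow> nat \<Rightarrow> nat" where
  "word_perm w = fold (\<lambda>a f. f \<circ> sw a) w id"

text \<open>red_w0 n w : w is in Sigma_(n+1), i.e. a reduced word of the longest element of S_(n+1).
  (A word of length N = l(w0) whose product is w0 is automatically reduced.)\<close>
definition red_w0 :: "nat \<Rightarrow> nat list \<Rightarrow> bool" where
  "red_w0 n w \<longleftrightarrow> length w = Nn n \<and> set w \<subseteq> {1..n} \<and>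
      (\<forall>p\<in>{1..n+1}. word_perm w p = n + 2 - p)"

text \<open>arr w j p : the wire in position p after the first j nodes.\<close>
definition arr :: "nat list \<Rightarrow> nat \<Rightarrow> nat \<Rightarrow> nat" where
  "arr w j = word_perm (take j w)"

text \<open>The two wires crossing at node t_j (nodes numbered 1..N).\<close>
definition node_wires :: "nat list \<Rightarrow> nat \<Rightarrow> nat set" where
  "node_wires w j = {arr w (j - 1) (w ! (j - 1)), arr w (j - 1) (Suc (w ! (j - 1)))}"

definition on_wire :: "nat list \<Rightarrow> nat \<Rightarrow> nat \<Rightarrow> bool" where
  "on_wire w l j \<longleftrightarrow> j \<in> {1..length w} \<and> l \<in> node_wires w j"

text \<open>In G(i,k) the wires l_1..l_k are oriented upward, the others downward.\<close>
definition upward :: "nat \<Rightarrow> nat \<Rightarrow> bool" where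
  "upward k l \<longleftrightarrow> l \<le> k"

text \<open>j' is the next node after j when moving along wire l in its orientation in G(i,k)
  (larger node index = lower in the diagram).\<close>
definition next_node :: "nat list \<Rightarrow> nat \<Rightarrow> nat \<Rightarrow> nat \<Rightarrow> nat \<Rightarrow> bool" where
  "next_node w k l j j' \<longleftrightarrow> on_wire w l j \<and> on_wire w l j' \<and>
     (if upward k l then j' < j \<and> (\<forall>j''. j' < j'' \<and> j'' < j \<longrightarrow> \<not> on_wire w l j'')
      else j < j' \<and> (\<forall>j''. j < j'' \<and> j'' < j' \<longrightarrow> \<not> on_wire w l j''))"

definition bottom_node :: "nat list \<Rightarrow> nat \<Rightarrow> nat \<Rightarrow> bool" where
  "bottom_node w l j \<longleftrightarrow> on_wire w l j \<and> (\<forall>j'. j < j' \<longrightarrow> \<not> on_wire w l j')"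

text \<open>Passing straight through l_a \<inter> l_c while on l_a is forbidden when both are downward
  with a > c, or both upward with a < c.\<close>
definition forbidden_straight :: "nat \<Rightarrow> nat \<Rightarrow> nat \<Rightarrow> bool" where
  "forbidden_straight k a c \<longleftrightarrow>
     (\<not> upward k a \<and> \<not> upward k c \<and> a > c) \<or> (upward k a \<and> upward k c \<and> a < c)"

text \<open>A path is recorded as the list of nodes it passes, in order, each with the wire on
  which it arrives and the wire on which it leaves: (j, incoming, outgoing).
  It starts at L_k (bottom of l_k, going up) and ends at L_(k+1) (bottom of l_(k+1)).\<close>
definition rigorous_path :: "nat list \<Rightarrow> nat \<Rightarrow> (nat \<times> nat \<times> nat) list \<Rightarrow> bool" where
  "rigorous_path w k ps \<longleftrightarrow> ps \<noteq> [] \<and> distinct (map fst ps) \<and>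
     (\<forall>(j, a, b) \<in> set ps. j \<in> {1..length w} \<and> a \<in> node_wires w j \<and> b \<in> node_wires w j \<and>
        (a = b \<longrightarrow> (\<forall>c\<in>node_wires w j. c \<noteq> a \<longrightarrow> \<not> forbidden_straight k a c))) \<and>
     (case hd ps of (j, a, b) \<Rightarrow> a = k \<and> bottom_node w k j) \<and>
     (case last ps of (j, a, b) \<Rightarrow> b = Suc k \<and> bottom_node w (Suc k) j) \<and>
     (\<forall>r. Suc r < length ps \<longrightarrow>
        (case ps ! r of (j, a, b) \<Rightarrow> case ps ! Suc r of (j', a', b') \<Rightarrow>
           a' = b \<and> next_node w k b j j'))"

definition string_lhs :: "(nat \<times> nat \<times> nat) list \<Rightarrow> (nat \<Rightarrow> real) \<Rightarrow> real" where
  "string_lhs ps t = sum_list (map (\<lambda>(j, a, b).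
      (if a < b then 1 else if b < a then -1 else 0) * t j) ps)"

definition lam_coef :: "nat list \<Rightarrow> nat \<Rightarrow> nat \<Rightarrow> real" where
  "lam_coef w j k = (let a = w ! (j - 1); b = w ! (k - 1) in
      if b = a then -2 else if b = Suc a \<or> a = Suc b then 1 else 0)"

text \<open>String polytope Delta_i(lambda) in R^N; points are functions supported on {1..N}.
  lam l is the coefficient lambda_l of the fundamental weight varpi_l.\<close>
definition string_polytope :: "nat \<Rightarrow> nat list \<Rightarrow> (nat \<Rightarrow> nat) \<Rightarrow> (nat \<Rightarrow> real) set" where
  "string_polytope n w lam = {t.
      (\<forall>j. j \<notin> {1..length w} \<longrightarrow> t j = 0) \<and>
      (\<forall>k\<in>{1..n}. \<forall>ps. rigorous_path w k ps \<longrightarrow> string_lhs ps t \<ge> 0) \<and>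
      (\<forall>j\<in>{1..length w}. t j \<le> real (lam (w ! (j - 1)))
          + (\<Sum>k\<in>{j<..length w}. lam_coef w j k * t k))}"

definition gc_index :: "nat \<Rightarrow> (nat \<times> nat) set" where
  "gc_index n = {(k, j). 1 \<le> j \<and> j \<le> k \<and> k \<le> n}"

text \<open>x_(k,j), with the convention x_(n+1,j) = lambda_j + ... + lambda_n (= 0 for j = n+1).\<close>
definition gcx :: "nat \<Rightarrow> (nat \<Rightarrow> nat) \<Rightarrow> (nat \<times> nat \<Rightarrow> real) \<Rightarrow> nat \<Rightarrow> nat \<Rightarrow> real" where
  "gcx n lam x k j = (if k = n + 1 then (\<Sum>l\<in>{j..n}. real (lam l)) else x (k, j))"

definition GC :: "nat \<Rightarrow> (nat \<Rightarrow> nat) \<Rightarrow> (nat \<times> nat \<Rightarrow> real) set" where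
  "GC n lam = {x. (\<forall>p. p \<notin> gc_index n \<longrightarrow> x p = 0) \<and>
      (\<forall>k j. 1 \<le> j \<and> j \<le> k \<and> k \<le> n \<longrightarrow>
         gcx n lam x (k + 1) j \<ge> gcx n lam x k j \<and> gcx n lam x k j \<ge> gcx n lam x (k + 1) (j + 1))}"

text \<open>P \<subseteq> R^I and Q \<subseteq> R^J (points = functions vanishing outside the finite index sets)
  are unimodularly equivalent if x \<mapsto> Mx + v maps P onto Q, with M an integer matrix
  with an integer two-sided inverse (M \<in> GL(Z)) and v integral.\<close>
definition unimod_equiv :: "'a set \<Rightarrow> 'b set \<Rightarrow> ('a \<Rightarrow> real) set \<Rightarrow> ('b \<Rightarrow> real) set \<Rightarrow> bool" where
  "unimod_equiv I J P Q \<longleftrightarrow> (\<exists>(M :: 'b \<Rightarrow> 'a \<Rightarrow> int) (M' :: 'a \<Rightarrow> 'b \<Rightarrow> int) (v :: 'b \<Rightarrow> int).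
      (\<forall>a\<in>I. \<forall>a'\<in>I. (\<Sum>b\<in>J. M' a b * M b a') = (if a = a' then 1 else 0)) \<and>
      (\<forall>b\<in>J. \<forall>b'\<in>J. (\<Sum>a\<in>I. M b a * M' a b') = (if b = b' then 1 else 0)) \<and>
      (\<lambda>x b. if b \<in> J then (\<Sum>a\<in>I. real_of_int (M b a) * x a) + real_of_int (v b) else 0) ` P = Q)"

definition two_move :: "nat list \<Rightarrow> nat list \<Rightarrow> bool" where
  "two_move xs ys \<longleftrightarrow> (\<exists>p q a b. xs = p @ [a, b] @ q \<and> ys = p @ [b, a] @ q \<and>
      (Suc a < b \<or> Suc b < a))"

definition word_equiv :: "nat list \<Rightarrow> nat list \<Rightarrow> bool" where
  "word_equiv = two_move\<^sup>*\<^sup>*"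

datatype AD = A | D

fun block :: "AD \<Rightarrow> nat \<Rightarrow> nat list" where
  "block D m = rev [1..<Suc m]"
| "block A m = [1..<Suc m]"

definition decomp :: "AD \<Rightarrow> nat \<Rightarrow> nat list \<Rightarrow> nat list \<times> nat list" where
  "decomp s m w = (SOME (u, v). word_equiv w (u @ block s m @ v))"

definition ind :: "AD \<Rightarrow> nat \<Rightarrow> nat list \<Rightarrow> nat" where
  "ind s m w = length (snd (decomp s m w))"

fun contr :: "AD \<Rightarrow> nat \<Rightarrow> nat list \<Rightarrow> nat list" where
  "contr D m w = fst (decomp D m w) @ map (\<lambda>x. x - 1) (snd (decomp D m w))"
| "contr A m w = map (\<lambda>x. x - 1) (fst (decomp A m w)) @ snd (decomp A m w)"

text \<open>iter_contr sigma n w d = C_(sigma_(n-d+1)) o ... o C_(sigma_n) (w), a word in Sigma_(n-d+1).\<close>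
fun iter_contr :: "(nat \<Rightarrow> AD) \<Rightarrow> nat \<Rightarrow> nat list \<Rightarrow> nat \<Rightarrow> nat list" where
  "iter_contr \<sigma> n w 0 = w"
| "iter_contr \<sigma> n w (Suc d) = contr (\<sigma> (n - d)) (n - d) (iter_contr \<sigma> n w d)"

end

theory Submission
  imports Defs
begin

text \<open>
  If \<open>ind\<^sub>D = 0\<close> then, up to 2-moves, the word is \<open>u (n, \<dots>, 1)\<close> with \<open>u \<in> \<Sigma>\<^sub>n\<close>. Wire \<open>n + 1\<close> crosses every other wire
  inside the final block, so a rigorous path either stays in the block, where it contributes one
  of \<open>a\<^sub>n \<ge> \<dots> \<ge> a\<^sub>1 \<ge> 0\<close> (\<open>a\<^sub>i\<close> being the coordinate of the block node with letter \<open>i\<close>), or passes straight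
  through it and is a rigorous path of \<open>u\<close>. The block nodes also give \<open>a\<^sub>i \<le> \<lambda>\<^sub>i + a\<^sub>i\<^sub>-\<^sub>1\<close>, and the remaining
  nodes see the weight \<open>\<lambda>'\<^sub>i = \<lambda>\<^sub>i - 2 a\<^sub>i + a\<^sub>i\<^sub>-\<^sub>1 + a\<^sub>i\<^sub>+\<^sub>1\<close>. Substituting
  \<open>x\<^sub>n\<^sub>,\<^sub>i = x\<^sub>n\<^sub>+\<^sub>1\<^sub>,\<^sub>i - a\<^sub>i + a\<^sub>i\<^sub>-\<^sub>1\<close>, where \<open>x\<^sub>n\<^sub>+\<^sub>1\<close> is the top Gelfand--Cetlin row, turns the block
  inequalities into the interlacing of rows \<open>n\<close> and \<open>n + 1\<close>, and \<open>\<lambda>'\<close> becomes the sequence of gaps of row \<open>n\<close>,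
  so one can recurse on \<open>u\<close>. The case \<open>ind\<^sub>A = 0\<close> is the reflection of this one under \<open>i \<mapsto> n + 1 - i\<close>, which
  reverses rigorous paths.
\<close>

subsection \<open>Crossings of wires\<close>

lemma sw_sw [simp]: "sw a (sw a p) = p"
  by (auto simp: sw_def)

text \<open>\<open>word_perm\<close> folds with the accumulator \<open>id\<close>; an arbitrary
  accumulator is what the induction, and through it multiplicativity, requires.\<close>

lemma fold_comp_sw:
  fixes g :: "nat \<Rightarrow> nat"
  shows "fold (\<lambda>a f. f \<circ> sw a) w g = g \<circ> word_perm w"
proof (induction w arbitrary: g)
  case (Cons a w)
  show ?case
    by (simp only: word_perm_def fold_simps) (simp only: Cons comp_assoc id_comp)
qed (simp add: word_perm_def)

lemma word_perm_append: "word_perm (u @ v) = word_perm u \<circ> word_perm v"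
proof -
  have "word_perm (u @ v) = fold (\<lambda>a f. f \<circ> sw a) v (word_perm u)"
    by (simp add: word_perm_def)
  then show ?thesis
    by (simp only: fold_comp_sw)
qed

lemma word_perm_Nil [simp]: "word_perm [] = id"
  by (simp add: word_perm_def)

lemma word_perm_Cons [simp]: "word_perm (a # w) = sw a \<circ> word_perm w"
  using word_perm_append[of "[a]" w] by (simp add: word_perm_def)

lemma inj_word_perm: "inj (word_perm w)"
proof (induction w)
  case (Cons a w)
  have "inj (sw a)"
    by (metis injI sw_sw)
  with Cons show ?case
    by (metis inj_compose word_perm_Cons)
qed simp

text \<open>\<open>fold sw w\<close> follows a wire from its top to its bottom position, while
  \<open>word_perm w\<close> reads off the wire found in a bottom position.\<close>

lemma word_perm_fold_sw [simp]: "word_perm w (fold sw w p) = p"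
  by (induction w arbitrary: p) auto

lemma node_wires_append_left:
  "1 \<le> j \<Longrightarrow> j \<le> length u \<Longrightarrow> node_wires (u @ v) j = node_wires u j"
  by (cases j) (auto simp: node_wires_def arr_def nth_append)

text \<open>Inside \<open>v\<close> a wire is named by its position at the top of \<open>v\<close>;
  below \<open>u\<close> that position is occupied by the wire that \<open>word_perm u\<close>
  lists.\<close>

lemma node_wires_append_right:
  "1 \<le> j \<Longrightarrow> node_wires (u @ v) (length u + j) = word_perm u ` node_wires v j"
  by (cases j) (auto simp: node_wires_def arr_def nth_append word_perm_append)

lemma node_wires_Cons_1: "node_wires (a # w) (Suc 0) = {a, Suc a}"
  by (simp add: node_wires_def arr_def)

lemma node_wires_Cons_Suc: "1 \<le> j \<Longrightarrow> node_wires (a # w) (Suc j) = sw a ` node_wires w j"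
  using node_wires_append_right[of j "[a]" w] by (simp add: word_perm_def)

text \<open>A letter keeps the left-right order of two wires unless it exchanges precisely these
  two, so a reversal can only come from a common node.\<close>

lemma wires_cross:
  assumes "a \<noteq> b" "(fold sw w a < fold sw w b) \<noteq> (a < b)"
  shows "\<exists>j\<in>{1..length w}. node_wires w j = {a, b}"
  using assms
proof (induction w arbitrary: a b)
  case (Cons c w)
  show ?case
  proof (cases "{a, b} = {c, Suc c}")
    case True
    then show ?thesis
      by (intro bexI[of _ 1]) (auto simp: node_wires_Cons_1)
  next
    case False
    then have "(sw c a < sw c b) = (a < b)" "sw c a \<noteq> sw c b"
      using Cons.prems(1) by (auto simp: sw_def doubleton_eq_iff)
    with Cons.prems have "\<exists>j\<in>{1..length w}. node_wires w j = {sw c a, sw c b}"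
      by (intro Cons.IH) simp_all
    then obtain j where j: "j \<in> {1..length w}" "node_wires w j = {sw c a, sw c b}" ..
    then have "node_wires (c # w) (Suc j) = {a, b}"
      by (simp add: node_wires_Cons_Suc)
    with j(1) show ?thesis
      by (intro bexI[of _ "Suc j"]) auto
  qed
qed simp

lemma Nn_Suc: "Nn (Suc n) = Nn n + Suc n"
  by (simp add: Nn_def)

lemma card_pairs: "card {S. S \<subseteq> {1..Suc n} \<and> card S = 2} = Nn n"
proof -
  have "card {S. S \<subseteq> {1..Suc n} \<and> card S = 2} = Suc n choose 2"
    using n_subsets[of "{1..Suc n}" 2] by simp
  then show ?thesis
    by (simp add: Nn_def choose_two mult.commute)
qed

text \<open>The word may use letters beyond \<open>n\<close> here; the count forces every crossing to take place
  among the wires \<open>1, \<dots>, n + 1\<close>, each pair meeting exactly once.\<close>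

lemma node_wires_bij:
  assumes len: "length w = Nn n" and rev: "\<forall>p\<in>{1..Suc n}. word_perm w p = n + 2 - p"
  shows "bij_betw (node_wires w) {1..length w} {S. S \<subseteq> {1..Suc n} \<and> card S = 2}"
proof -
  let ?T = "{S. S \<subseteq> {1..Suc n} \<and> card S = 2}"
  have track: "fold sw w a = n + 2 - a" if "a \<in> {1..Suc n}" for a
  proof -
    have "word_perm w (n + 2 - a) = a"
      using that bspec[OF rev, of "n + 2 - a"] by fastforce
    then show ?thesis
      by (metis inj_word_perm injD word_perm_fold_sw)
  qed
  \<comment> \<open>Every pair is reversed between top and bottom, so \<open>wires_cross\<close>
    supplies a node for it.\<close>
  have sub: "?T \<subseteq> node_wires w ` {1..length w}"
  proof
    fix S assume "S \<in> ?T"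
    then obtain a b where ab: "S = {a, b}" "a \<noteq> b" "a \<in> {1..Suc n}" "b \<in> {1..Suc n}"
      by (auto simp: card_2_iff)
    then have "(fold sw w a < fold sw w b) \<noteq> (a < b)"
      using track[of a] track[of b] by auto
    then show "S \<in> node_wires w ` {1..length w}"
      using wires_cross[OF ab(2)] ab(1) by (metis imageI)
  qed
  have "card (node_wires w ` {1..length w}) \<le> card ?T"
    using card_image_le[of "{1..length w}" "node_wires w"] len card_pairs[of n] by simp
  then have eq: "node_wires w ` {1..length w} = ?T"
    using card_seteq[OF _ sub] by simp
  then have "inj_on (node_wires w) {1..length w}"
    using card_pairs[of n] len by (intro eq_card_imp_inj_on) auto
  with eq show ?thesis
    by (simp add: bij_betw_def)
qed

section \<open>Descending and ascending blocks\<close>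

lemma length_block [simp]: "length (block s n) = n"
  by (cases s) auto

lemma set_block [simp]: "set (block s n) = {1..n}"
  by (cases s) auto

lemma block_D_Suc: "block D (Suc n) = Suc n # block D n"
  by simp

declare block.simps [simp del]

lemma block_D_nth: "i < n \<Longrightarrow> block D n ! i = n - i"
  by (simp add: block.simps rev_nth del: upt_Suc)

lemma block_A_nth: "i < n \<Longrightarrow> block A n ! i = Suc i"
  by (simp add: block.simps del: upt_Suc)

lemma word_perm_block_D:
  "word_perm (block D n) p = (if p = 1 then n + 1 else if 2 \<le> p \<and> p \<le> n + 1 then p - 1 else p)"
proof (induction n)
  case 0
  then show ?case by (simp add: block.simps)
next
  case (Suc n)
  then show ?case by (auto simp: block_D_Suc sw_def)
qed

text \<open>Each letter moves the same wire \<open>n + 1\<close> one place further to the left, past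
  \<open>n\<close>, \<open>n - 1\<close>, ..., 1 in turn.\<close>

lemma node_wires_block_D:
  "1 \<le> i \<Longrightarrow> i \<le> n \<Longrightarrow> node_wires (block D n) i = {n + 1 - i, n + 1}"
proof (induction n arbitrary: i)
  case (Suc n)
  show ?case
  proof (cases "i = 1")
    case True
    then show ?thesis by (simp add: block_D_Suc node_wires_Cons_1)
  next
    case False
    then obtain j where j: "i = Suc j" "1 \<le> j" "j \<le> n"
      using Suc.prems by (cases i) auto
    then show ?thesis
      using Suc.IH[of j] by (auto simp: block_D_Suc node_wires_Cons_Suc sw_def)
  qed
qed simp

text \<open>The product forces \<open>u\<close> to fix \<open>n + 2\<close> and to reverse the rest.
  As \<open>u\<close> has just enough letters for the crossings among the wires up to
  \<open>n + 1\<close>, \<open>node_wires_bij\<close> leaves no node for wire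
  \<open>n + 2\<close>.\<close>

lemma red_w0_split_D:
  assumes "red_w0 (Suc n) (u @ block D (Suc n))"
  shows "red_w0 n u"
    and "\<forall>j\<in>{1..length u}. node_wires u j \<subseteq> {1..Suc n}"
    and "\<forall>i\<in>{1..Suc n}. node_wires (u @ block D (Suc n)) (length u + i) = {i, n + 2}"
proof -
  have len: "length u = Nn n"
    using assms by (simp add: red_w0_def Nn_Suc)
  have w: "word_perm u (word_perm (block D (Suc n)) p) = n + 3 - p" if "p \<in> {1..n+2}" for p
    using assms that by (simp add: red_w0_def word_perm_append)
  have top: "word_perm u (n + 2) = n + 2"
    using w[of 1] by (simp add: word_perm_block_D)
  have rev: "\<forall>q\<in>{1..Suc n}. word_perm u q = n + 2 - q"
  proof
    fix q assume "q \<in> {1..Suc n}"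
    then show "word_perm u q = n + 2 - q"
      using w[of "Suc q"] by (simp add: word_perm_block_D)
  qed
  have bij: "bij_betw (node_wires u) {1..length u} {S. S \<subseteq> {1..Suc n} \<and> card S = 2}"
    using node_wires_bij[OF len rev] .
  then show sub: "\<forall>j\<in>{1..length u}. node_wires u j \<subseteq> {1..Suc n}"
    unfolding bij_betw_def by blast
  have letter: "a \<in> {1..Suc n}" if "a \<in> set u" for a
    using assms that by (auto simp: red_w0_def)
  \<comment> \<open>While wire \<open>n + 2\<close> sits in position \<open>n + 2\<close>, only the
    letter \<open>n + 1\<close> could move it, and that would be a crossing of it inside
    \<open>u\<close>, contrary to \<open>sub\<close>.\<close>
  have fix_top: "arr u j (n + 2) = n + 2 \<and> (\<forall>i<j. u ! i \<noteq> Suc n)" if "j \<le> length u" for j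
    using that
  proof (induction j)
    case 0
    then show ?case by (simp add: arr_def)
  next
    case (Suc j)
    then have IH: "arr u j (n + 2) = n + 2" "\<forall>i<j. u ! i \<noteq> Suc n"
      by auto
    have "u ! j \<noteq> Suc n"
    proof
      assume "u ! j = Suc n"
      then have "n + 2 \<in> node_wires u (Suc j)"
        using IH(1) by (simp add: node_wires_def)
      then show False
        using sub Suc.prems by fastforce
    qed
    moreover have "u ! j \<le> Suc n"
      using letter[of "u ! j"] Suc.prems by simp
    ultimately have "sw (u ! j) (n + 2) = n + 2"
      by (simp add: sw_def)
    with IH \<open>u ! j \<noteq> Suc n\<close> Suc.prems show ?case
      by (auto simp: arr_def take_Suc_conv_app_nth word_perm_append less_Suc_eq)
  qed
  have "a \<in> {1..n}" if "a \<in> set u" for a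
  proof -
    have "a \<noteq> Suc n"
      using fix_top[of "length u"] that by (auto simp: in_set_conv_nth)
    then show ?thesis
      using letter[OF that] by auto
  qed
  then show "red_w0 n u"
    using len rev by (auto simp: red_w0_def)
  show "\<forall>i\<in>{1..Suc n}. node_wires (u @ block D (Suc n)) (length u + i) = {i, n + 2}"
  proof
    fix i assume i: "i \<in> {1..Suc n}"
    then have "word_perm u (n + 2 - i) = i"
      using bspec[OF rev, of "n + 2 - i"] by fastforce
    with i top show "node_wires (u @ block D (Suc n)) (length u + i) = {i, n + 2}"
      by (simp add: node_wires_append_right node_wires_block_D)
  qed
qed

section \<open>Reduced words under 2-moves\<close>

lemma sw_commute: "Suc a < b \<or> Suc b < a \<Longrightarrow> sw a (sw b p) = sw b (sw a p)"
  by (auto simp: sw_def)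

lemma two_move_word_perm: "two_move w w' \<Longrightarrow> word_perm w' = word_perm w"
  by (auto simp: two_move_def word_perm_append fun_eq_iff intro!: arg_cong[of _ _ "word_perm _"] sw_commute)

lemma two_move_set: "two_move w w' \<Longrightarrow> set w' = set w"
  by (auto simp: two_move_def)

lemma two_move_length: "two_move w w' \<Longrightarrow> length w' = length w"
  by (auto simp: two_move_def)

lemma word_equiv_set: "word_equiv w w' \<Longrightarrow> set w' = set w"
  unfolding word_equiv_def by (induction rule: rtranclp_induct) (use two_move_set in blast)+

lemma two_move_red_w0: "two_move w w' \<Longrightarrow> red_w0 n w \<Longrightarrow> red_w0 n w'"
  unfolding red_w0_def
  by (simp only: two_move_word_perm [of w w'] two_move_set [of w w'] two_move_length [of w w']) simp

lemma word_equiv_red_w0: "word_equiv w w' \<Longrightarrow> red_w0 n w \<Longrightarrow> red_w0 n w'"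
  unfolding word_equiv_def by (induction rule: rtranclp_induct) (auto intro: two_move_red_w0)

subsection \<open>Splitting off a final block\<close>

definition crossings :: "nat list \<Rightarrow> nat \<Rightarrow> nat" where
  "crossings w p = card {j \<in> {1..length w}. p \<in> node_wires w j}"

lemma crossings_Cons:
  "crossings (a # w) p = (if p = a \<or> p = Suc a then 1 else 0) + crossings w (sw a p)"
proof -
  let ?J = "{j \<in> {1..length w}. sw a p \<in> node_wires w j}"
  have mem: "p \<in> node_wires (a # w) (Suc j) \<longleftrightarrow> sw a p \<in> node_wires w j" if "1 \<le> j" for j
    using that by (simp add: node_wires_Cons_Suc) (metis image_iff sw_sw)
  have "{j \<in> {1..length (a # w)}. p \<in> node_wires (a # w) j} =
      (if p = a \<or> p = Suc a then {1} else {}) \<union> Suc ` ?J" (is "?L = ?R")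
  proof (rule set_eqI)
    fix j
    show "j \<in> ?L \<longleftrightarrow> j \<in> ?R"
    proof (cases "j \<le> 1")
      case True
      then show ?thesis
        by (cases "j = 1") (auto simp: node_wires_Cons_1)
    next
      case False
      then obtain i where "j = Suc i" "1 \<le> i"
        by (cases j) auto
      then show ?thesis
        using mem[of i] by auto
    qed
  qed
  then have "crossings (a # w) p = card ((if p = a \<or> p = Suc a then {1} else {}) \<union> Suc ` ?J)"
    by (simp add: crossings_def)
  also have "\<dots> = card (if p = a \<or> p = Suc a then {1::nat} else {}) + card (Suc ` ?J)"
    by (rule card_Un_disjoint) auto
  also have "card (Suc ` ?J) = crossings w (sw a p)"
    by (simp add: card_image crossings_def)
  finally show ?thesis
    by simp
qed

text \<open>One crossing moves a wire by one position. The bound excludes moves to the right for a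
  wire that reaches position 1 with only \<open>p - 1\<close> crossings.\<close>

lemma position_le: "p \<le> fold sw w p + crossings w p"
proof (induction w arbitrary: p)
  case (Cons a w)
  show ?case
    using Cons[of "sw a p"] by (auto simp: crossings_Cons sw_def split: if_splits)
qed simp

lemma word_equiv_trans [trans]: "word_equiv u v \<Longrightarrow> word_equiv v w \<Longrightarrow> word_equiv u w"
  by (simp add: word_equiv_def)

lemma two_move_append: "two_move u v \<Longrightarrow> two_move (x @ u @ y) (x @ v @ y)"
  unfolding two_move_def by (metis append.assoc)

lemma word_equiv_append: "word_equiv u v \<Longrightarrow> word_equiv (x @ u @ y) (x @ v @ y)"
  unfolding word_equiv_def
proof (induction rule: rtranclp_induct)
  case (step v v')
  then show ?case
    using two_move_append[of v v' x y] by (meson rtranclp.rtrancl_into_rtrancl)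
qed simp

lemma word_equiv_commute:
  "\<forall>b\<in>set u. Suc a < b \<or> Suc b < a \<Longrightarrow> word_equiv (a # u @ v) (u @ a # v)"
proof (induction u)
  case Nil
  show ?case by (simp add: word_equiv_def)
next
  case (Cons b u)
  have "two_move (a # b # u @ v) (b # a # u @ v)"
    using Cons.prems unfolding two_move_def by (metis append_Cons append_Nil list.set_intros(1))
  then have "word_equiv (a # b # u @ v) (b # a # u @ v)"
    by (simp add: word_equiv_def)
  also have "word_equiv (b # a # u @ v) (b # u @ a # v)"
    using word_equiv_append[of _ _ "[b]" "[]"] Cons by simp
  finally show ?case by simp
qed

text \<open>The wire at position \<open>p\<close> reaches position 1 with the least possible number of crossings, so it
  never moves to the right. Letters left of the wire commute past its earlier crossings, letters
  right of it past its later ones.\<close>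

lemma descending_wire_decomp:
  assumes "fold sw w p = 1" "Suc (crossings w p) = p" "0 \<notin> set w"
  shows "\<exists>u v. word_equiv w (u @ block D (p - 1) @ v) \<and> (\<forall>a\<in>set u. Suc a < p)"
  using assms
proof (induction w arbitrary: p)
  case Nil
  then show ?case
    by (intro exI[of _ "[]"]) (simp add: word_equiv_def block.simps)
next
  case (Cons a w)
  have fold: "fold sw w (sw a p) = 1"
    using Cons.prems by simp
  consider "a = p" | "Suc a = p" | "Suc a < p" | "p < a"
    by linarith
  then show ?case
  proof cases
    \<comment> \<open>The letter \<open>p\<close> would move the wire to position
      \<open>p + 1\<close>, with only \<open>p - 2\<close> crossings left to reach position
      1.\<close>
    case 1
    then have False
      using position_le[of "Suc p" w] fold Cons.prems(2) by (simp add: crossings_Cons sw_def)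
    then show ?thesis ..
  next
    case 2
    then have "sw a p = a"
      by (auto simp: sw_def)
    moreover have "Suc (crossings w a) = a"
      using 2 Cons.prems(2,3) \<open>sw a p = a\<close> by (simp add: crossings_Cons)
    ultimately obtain u v where
      uv: "word_equiv w (u @ block D (a - 1) @ v)" "\<forall>b\<in>set u. Suc b < a"
      using Cons.IH[of a] fold Cons.prems(3) by auto
    have "word_equiv (a # w) (a # u @ block D (a - 1) @ v)"
      using word_equiv_append[OF uv(1), of "[a]" "[]"] by simp
    \<comment> \<open>The first crossing \<open>a\<close> of the wire commutes past \<open>u\<close>
      by the bound on the letters of \<open>u\<close> and becomes the first letter of the longer
      block.\<close>
    also have "word_equiv \<dots> (u @ a # block D (a - 1) @ v)"
      using uv(2) by (intro word_equiv_commute) auto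
    also have "u @ a # block D (a - 1) @ v = u @ block D (p - 1) @ v"
      using 2 Cons.prems(3) by (cases a) (auto simp: block_D_Suc)
    finally show ?thesis
      using uv(2) 2 by (intro exI conjI) auto
  next
    case 3
    then have "sw a p = p"
      by (auto simp: sw_def)
    with 3 obtain u v where uv: "word_equiv w (u @ block D (p - 1) @ v)" "\<forall>b\<in>set u. Suc b < p"
      using Cons.IH[of p] fold Cons.prems(2,3) by (auto simp: crossings_Cons)
    show ?thesis
      using word_equiv_append[OF uv(1), of "[a]" "[]"] uv(2) 3
      by (intro exI[of _ "a # u"] exI[of _ v]) simp
  next
    case 4
    then have "sw a p = p"
      by (auto simp: sw_def)
    with 4 obtain u v where uv: "word_equiv w (u @ block D (p - 1) @ v)" "\<forall>b\<in>set u. Suc b < p"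
      using Cons.IH[of p] fold Cons.prems(2,3) by (auto simp: crossings_Cons)
    have "word_equiv (a # w) (a # (u @ block D (p - 1)) @ v)"
      using word_equiv_append[OF uv(1), of "[a]" "[]"] by simp
    \<comment> \<open>Here \<open>a\<close> exceeds all letters of \<open>u\<close> and of the block
      by at least 2, so it can join \<open>v\<close>.\<close>
    also have "word_equiv \<dots> ((u @ block D (p - 1)) @ a # v)"
      using uv(2) 4 by (intro word_equiv_commute) auto
    finally show ?thesis
      using uv(2) by auto
  qed
qed

text \<open>Wire \<open>n + 1\<close> meets each of the \<open>n\<close> other wires once and ends
  in position 1, so it has the minimal number of crossings that
  \<open>descending_wire_decomp\<close> asks for.\<close>

lemma ex_decomp_D:
  assumes "red_w0 n w"
  shows "\<exists>u v. word_equiv w (u @ block D n @ v)"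
proof -
  let ?T = "{S. S \<subseteq> {1..Suc n} \<and> card S = 2}"
  have bij: "bij_betw (node_wires w) {1..length w} ?T"
    using assms by (intro node_wires_bij) (auto simp: red_w0_def)
  then have "bij_betw (node_wires w) {j \<in> {1..length w}. Suc n \<in> node_wires w j}
      {S \<in> ?T. Suc n \<in> S}"
    by (rule bij_betw_subset) (use bij_betw_imp_surj_on[OF bij] in blast)+
  then have "crossings w (Suc n) = card {S \<in> ?T. Suc n \<in> S}"
    unfolding crossings_def by (rule bij_betw_same_card)
  also have "{S \<in> ?T. Suc n \<in> S} = (\<lambda>a. {a, Suc n}) ` {1..n}"
  proof (intro set_eqI iffI)
    fix S assume S: "S \<in> {S \<in> ?T. Suc n \<in> S}"
    then obtain a where a: "S = {a, Suc n}" "a \<noteq> Suc n"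
      by (auto simp: card_2_iff)
    then have "a \<in> {1..n}"
      using S by auto
    with a show "S \<in> (\<lambda>a. {a, Suc n}) ` {1..n}"
      by blast
  qed auto
  also have "card \<dots> = n"
    by (subst card_image) (auto simp: inj_on_def doubleton_eq_iff)
  finally have c: "crossings w (Suc n) = n" .
  have "word_perm w 1 = Suc n"
    using assms by (simp add: red_w0_def)
  then have "fold sw w (Suc n) = 1"
    by (metis inj_word_perm injD word_perm_fold_sw)
  with c show ?thesis
    using descending_wire_decomp[of w "Suc n"] assms by (fastforce simp: red_w0_def)
qed

section \<open>Left-right reflection of wiring diagrams\<close>

definition mirror :: "nat \<Rightarrow> nat list \<Rightarrow> nat list" where
  "mirror n w = map (\<lambda>a. Suc n - a) w"

lemma mirror_append [simp]: "mirror n (u @ v) = mirror n u @ mirror n v"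
  by (simp add: mirror_def)

lemma length_mirror [simp]: "length (mirror n w) = length w"
  by (simp add: mirror_def)

lemma set_mirror: "set w \<subseteq> {1..n} \<Longrightarrow> set (mirror n w) \<subseteq> {1..n}"
  by (auto simp: mirror_def subset_iff)

lemma mirror_mirror: "set w \<subseteq> {1..n} \<Longrightarrow> mirror n (mirror n w) = w"
  by (auto simp: mirror_def intro!: map_idI)

lemma mirror_block_D: "mirror n (block D n) = block A n"
  by (rule nth_equalityI) (auto simp: mirror_def block_D_nth block_A_nth)

lemma mirror_block_A: "mirror n (block A n) = block D n"
  using mirror_mirror[of "block D n" n] by (simp add: mirror_block_D)

lemma word_perm_range:
  "set w \<subseteq> {1..n} \<Longrightarrow> p \<in> {1..Suc n} \<Longrightarrow> word_perm w p \<in> {1..Suc n}"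
  by (induction w) (auto simp: sw_def)

text \<open>Conjugation by the longest element carries \<open>sw a\<close> to
  \<open>sw (Suc n - a)\<close>. The truncated subtractions are honest reflections on the given
  ranges.\<close>

lemma word_perm_mirror:
  assumes "set w \<subseteq> {1..n}" "p \<in> {1..Suc n}"
  shows "word_perm (mirror n w) p = n + 2 - word_perm w (n + 2 - p)"
  using assms
proof (induction w)
  case (Cons a w)
  have "word_perm w (n + 2 - p) \<in> {1..Suc n}"
    using Cons.prems by (intro word_perm_range) auto
  with Cons show ?case
    by (auto simp: mirror_def sw_def)
qed (auto simp: mirror_def)

lemma node_wires_mirror:
  assumes "set w \<subseteq> {1..n}" "j \<in> {1..length w}"
  shows "node_wires (mirror n w) j = (\<lambda>l. n + 2 - l) ` node_wires w j"
proof -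
  have "w ! (j - 1) \<in> set w"
    using assms(2) by auto
  then have a: "w ! (j - 1) \<in> {1..n}"
    using assms(1) by blast
  have take: "take (j - 1) (mirror n w) = mirror n (take (j - 1) w)"
    by (simp add: mirror_def take_map)
  have "set (take (j - 1) w) \<subseteq> {1..n}"
    using assms(1) set_take_subset by fast
  note perm = word_perm_mirror[OF this]
  have nth: "mirror n w ! (j - 1) = Suc n - w ! (j - 1)"
    using assms(2) by (cases j) (simp_all add: mirror_def)
  \<comment> \<open>The reflected letter acts on positions \<open>n + 1 - x\<close> and
    \<open>n + 2 - x\<close>, the mirror images of \<open>x + 1\<close> and \<open>x\<close>, so the
    two wires of the node trade places.\<close>
  have "word_perm (mirror n (take (j - 1) w)) (Suc n - x) = n + 2 - word_perm (take (j - 1) w) (Suc x)"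
    "word_perm (mirror n (take (j - 1) w)) (Suc (Suc n - x)) = n + 2 - word_perm (take (j - 1) w) x"
    if "x \<in> {1..n}" for x
  proof -
    have "n + 2 - (Suc n - x) = Suc x" "n + 2 - Suc (Suc n - x) = x"
      using that by auto
    then show "word_perm (mirror n (take (j - 1) w)) (Suc n - x) = n + 2 - word_perm (take (j - 1) w) (Suc x)"
      "word_perm (mirror n (take (j - 1) w)) (Suc (Suc n - x)) = n + 2 - word_perm (take (j - 1) w) x"
      using perm[of "Suc n - x"] perm[of "Suc (Suc n - x)"] that by auto
  qed
  from this[OF a] show ?thesis
    unfolding node_wires_def arr_def take nth by auto
qed

lemma red_w0_mirror:
  assumes "red_w0 n w"
  shows "red_w0 n (mirror n w)"
proof -
  have "word_perm (mirror n w) p = n + 2 - p" if p: "p \<in> {1..n + 1}" for p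
  proof -
    have "n + 2 - p \<in> {1..n + 1}"
      using p by auto
    then show ?thesis
      using assms p by (simp add: red_w0_def word_perm_mirror)
  qed
  then show ?thesis
    using assms set_mirror[of w n] by (simp add: red_w0_def)
qed

lemma two_move_mirror:
  assumes "two_move w w'" "set w \<subseteq> {1..n}"
  shows "two_move (mirror n w) (mirror n w')"
proof -
  obtain p q a b where w: "w = p @ [a, b] @ q" "w' = p @ [b, a] @ q" "Suc a < b \<or> Suc b < a"
    using assms(1) by (auto simp: two_move_def)
  then have "Suc (Suc n - a) < Suc n - b \<or> Suc (Suc n - b) < Suc n - a"
    using assms(2) by auto
  moreover have "mirror n w = mirror n p @ [Suc n - a, Suc n - b] @ mirror n q"
    "mirror n w' = mirror n p @ [Suc n - b, Suc n - a] @ mirror n q"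
    using w by (simp_all add: mirror_def)
  ultimately show ?thesis
    unfolding two_move_def by blast
qed

lemma word_equiv_mirror:
  assumes "word_equiv w w'" "set w \<subseteq> {1..n}"
  shows "word_equiv (mirror n w) (mirror n w')"
  using assms(1) unfolding word_equiv_def
proof (induction rule: rtranclp_induct)
  case (step v v')
  then have "set v \<subseteq> {1..n}"
    using word_equiv_set[of w v] assms(2) by (simp add: word_equiv_def)
  with step show ?case
    using two_move_mirror by (meson rtranclp.rtrancl_into_rtrancl)
qed simp

lemma ex_decomp:
  assumes "red_w0 n w"
  shows "\<exists>u v. word_equiv w (u @ block s n @ v)"
proof (cases s)
  case D
  then show ?thesis
    using ex_decomp_D[OF assms] by simp
next
  case A
  have w: "set w \<subseteq> {1..n}"
    using assms by (simp add: red_w0_def)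
  obtain u v where "word_equiv (mirror n w) (u @ block D n @ v)"
    using ex_decomp_D[OF red_w0_mirror[OF assms]] by blast
  then have "word_equiv (mirror n (mirror n w)) (mirror n (u @ block D n @ v))"
    using word_equiv_mirror set_mirror[OF w] by blast
  then show ?thesis
    using A mirror_mirror[OF w] by (auto simp: mirror_block_D)
qed

text \<open>Existence of a decomposition makes the choice in \<open>decomp\<close> a genuine one,
  and index 0 says that nothing follows the block.\<close>

lemma word_equiv_decomp:
  assumes "red_w0 n w" "ind s n w = 0"
  shows "word_equiv w (fst (decomp s n w) @ block s n)"
proof -
  have "case decomp s n w of (u, v) \<Rightarrow> word_equiv w (u @ block s n @ v)"
    unfolding decomp_def by (rule someI_ex) (use ex_decomp[OF assms(1)] in auto)
  then show ?thesis
    using assms(2) by (simp add: ind_def split: prod.splits)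
qed

text \<open>Reflection turns the ascending block into a descending one, so
  \<open>red_w0_split_D\<close> applies. Reflecting the remainder back in rank \<open>n\<close>
  instead of \<open>n + 1\<close> sends \<open>a\<close> to
  \<open>n + 1 - (n + 2 - a) = a - 1\<close>, which is the shift in the contraction.\<close>

lemma red_w0_split_A:
  assumes "red_w0 (Suc n) (u @ block A (Suc n))"
  shows "set u \<subseteq> {2..Suc n}" and "red_w0 n (map (\<lambda>x. x - 1) u)"
    and "red_w0 (Suc n) (mirror (Suc n) u @ block D (Suc n))"
    and "mirror n (mirror (Suc n) u) = map (\<lambda>x. x - 1) u"
proof -
  let ?m = "mirror (Suc n) u"
  have letters: "set u \<subseteq> {1..Suc n}"
    using assms by (simp add: red_w0_def)
  show red: "red_w0 (Suc n) (?m @ block D (Suc n))"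
    using red_w0_mirror[OF assms] by (simp add: mirror_block_A)
  have red': "red_w0 n ?m"
    by (rule red_w0_split_D(1)[OF red])
  then have "Suc (Suc n) - a \<in> {1..n}" if "a \<in> set u" for a
    using that by (auto simp: red_w0_def mirror_def)
  then show "set u \<subseteq> {2..Suc n}"
    using letters by fastforce
  then show m: "mirror n ?m = map (\<lambda>x. x - 1) u"
    by (auto simp: mirror_def)
  show "red_w0 n (map (\<lambda>x. x - 1) u)"
    using red_w0_mirror[OF red'] m by simp
qed

subsection \<open>String inequalities\<close>

definition string_ineqs :: "nat \<Rightarrow> nat list \<Rightarrow> (nat \<Rightarrow> real) \<Rightarrow> bool" where
  "string_ineqs n w t \<longleftrightarrow> (\<forall>k\<in>{1..n}. \<forall>ps. rigorous_path w k ps \<longrightarrow> string_lhs ps t \<ge> 0)"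

lemma string_lhs_simps [simp]:
  "string_lhs [] t = 0"
  "string_lhs ((j, a, b) # ps) t =
     (if a < b then 1 else if b < a then -1 else 0) * t j + string_lhs ps t"
  "string_lhs (ps @ qs) t = string_lhs ps t + string_lhs qs t"
  by (simp_all add: string_lhs_def)

text \<open>The conditions on a path are split into local predicates so that, by means of
  \<open>successively\<close>, paths can be mapped, reversed, cut and extended.\<close>

fun link :: "nat list \<Rightarrow> nat \<Rightarrow> nat \<times> nat \<times> nat \<Rightarrow> nat \<times> nat \<times> nat \<Rightarrow> bool" where
  "link w k (j, a, b) (j', a', b') \<longleftrightarrow> a' = b \<and> next_node w k b j j'"

fun visit :: "nat list \<Rightarrow> nat \<Rightarrow> nat \<times> nat \<times> nat \<Rightarrow> bool" where
  "visit w k (j, a, b) \<longleftrightarrow> on_wire w a j \<and> on_wire w b j \<and>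
     (a = b \<longrightarrow> (\<forall>c\<in>node_wires w j. c \<noteq> a \<longrightarrow> \<not> forbidden_straight k a c))"

fun start :: "nat list \<Rightarrow> nat \<Rightarrow> nat \<times> nat \<times> nat \<Rightarrow> bool" where
  "start w k (j, a, b) \<longleftrightarrow> a = k \<and> bottom_node w k j"

fun finish :: "nat list \<Rightarrow> nat \<Rightarrow> nat \<times> nat \<times> nat \<Rightarrow> bool" where
  "finish w k (j, a, b) \<longleftrightarrow> b = Suc k \<and> bottom_node w (Suc k) j"

lemma rigorous_path_iff:
  "rigorous_path w k ps \<longleftrightarrow> ps \<noteq> [] \<and> distinct (map fst ps) \<and> (\<forall>e\<in>set ps. visit w k e) \<and>
     start w k (hd ps) \<and> finish w k (last ps) \<and> successively (link w k) ps"
proof -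
  have visit: "visit w k = (\<lambda>(j, a, b). j \<in> {1..length w} \<and> a \<in> node_wires w j \<and>
      b \<in> node_wires w j \<and> (a = b \<longrightarrow> (\<forall>c\<in>node_wires w j. c \<noteq> a \<longrightarrow> \<not> forbidden_straight k a c)))"
    by (auto simp: on_wire_def fun_eq_iff)
  have link: "link w k e e' =
      (case e of (j, a, b) \<Rightarrow> case e' of (j', a', b') \<Rightarrow> a' = b \<and> next_node w k b j j')" for e e'
    by (cases e; cases e') simp
  have start: "start w k e = (case e of (j, a, b) \<Rightarrow> a = k \<and> bottom_node w k j)" for e
    by (cases e) simp
  have finish: "finish w k e = (case e of (j, a, b) \<Rightarrow> b = Suc k \<and> bottom_node w (Suc k) j)" for e
    by (cases e) simp
  show ?thesis
    unfolding rigorous_path_def successively_conv_nth visit link start finish by (rule refl)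
qed

subsection \<open>Invariance under 2-moves and reflection\<close>

text \<open>A path sees only which wires meet at a node and the order of the nodes along each wire.
  Nodes without a common wire may therefore change their order.\<close>

lemma rigorous_path_relabel:
  assumes bij: "bij_betw \<tau> {1..length w} {1..length w'}"
    and wires: "\<And>j. j \<in> {1..length w} \<Longrightarrow> node_wires w' (\<tau> j) = node_wires w j"
    and ord: "\<And>j j' l. on_wire w l j \<Longrightarrow> on_wire w l j' \<Longrightarrow> \<tau> j < \<tau> j' \<longleftrightarrow> j < j'"
    and path: "rigorous_path w k ps"
  shows "rigorous_path w' k (map (\<lambda>(j, a, b). (\<tau> j, a, b)) ps)"
proof -
  let ?f = "\<lambda>(j, a, b). (\<tau> j, a, b)"
  have range: "\<tau> j \<in> {1..length w'}" if "j \<in> {1..length w}" for j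
    using bij that by (auto simp: bij_betw_def)
  have on: "on_wire w' l (\<tau> j)" if "on_wire w l j" for l j
    using that range wires unfolding on_wire_def by metis
  \<comment> \<open>Surjectivity along each wire: no foreign node can come between two consecutive
    ones.\<close>
  have preimage: "\<exists>i. j = \<tau> i \<and> on_wire w l i" if "on_wire w' l j" for l j
  proof -
    have "j \<in> \<tau> ` {1..length w}"
      using that bij by (simp add: on_wire_def bij_betw_def)
    then show ?thesis
      using that wires by (auto simp: on_wire_def)
  qed
  have "next_node w' k l (\<tau> j) (\<tau> j')" if "next_node w k l j j'" for l j j'
    using that on preimage ord unfolding next_node_def by (smt (verit, best))
  then have link: "link w' k (?f e) (?f e')" if "link w k e e'" for e e'
    using that by (cases e; cases e') simp
  have bottom: "bottom_node w' l (\<tau> j)" if "bottom_node w l j" for l j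
    using that on preimage ord unfolding bottom_node_def by (smt (verit, best))
  have visit: "visit w' k (?f e)" if "visit w k e" for e
    using that on wires by (cases e) (auto simp: on_wire_def)
  have ps: "ps \<noteq> []" "distinct (map fst ps)" "\<forall>e\<in>set ps. visit w k e" "start w k (hd ps)"
    "finish w k (last ps)" "successively (link w k) ps"
    using path by (auto simp: rigorous_path_iff)
  have "map fst (map ?f ps) = map \<tau> (map fst ps)"
    by auto
  moreover have "inj_on \<tau> (set (map fst ps))"
  proof (rule inj_on_subset)
    show "inj_on \<tau> {1..length w}"
      using bij by (simp add: bij_betw_def)
    show "set (map fst ps) \<subseteq> {1..length w}"
      using ps(3) by (fastforce simp: on_wire_def)
  qed
  ultimately have "distinct (map fst (map ?f ps))"
    using ps(2) by (simp only: distinct_map)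
  moreover have "start w' k (?f (hd ps))"
    using ps(4) bottom by (cases "hd ps") simp
  moreover have "finish w' k (?f (last ps))"
    using ps(5) bottom by (cases "last ps") simp
  moreover have "successively (link w' k) (map ?f ps)"
    unfolding successively_map by (rule successively_mono[OF ps(6)]) (rule link)
  moreover have "\<forall>e\<in>set (map ?f ps). visit w' k e"
    using ps(3) visit by auto
  ultimately show ?thesis
    using ps(1) unfolding rigorous_path_iff by (simp add: hd_map last_map)
qed

lemma string_lhs_relabel:
  "string_lhs (map (\<lambda>(j, a, b). (\<tau> j, a, b)) ps) t = string_lhs ps (t \<circ> \<tau>)"
  by (induction ps) auto

text \<open>The two nodes exchanged by a 2-move share no wire, so exchanging their numbers is an
  admissible relabelling.\<close>

lemma string_ineqs_two_move:
  assumes w: "w = p @ [a, b] @ q" "w' = p @ [b, a] @ q" "Suc a < b \<or> Suc b < a"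
  defines "\<tau> \<equiv> sw (Suc (length p))"
  shows "string_ineqs n w' t \<longleftrightarrow> string_ineqs n w (t \<circ> \<tau>)"
proof -
  \<comment> \<open>One implication for general words suffices, since the situation is symmetric in
    \<open>w\<close> and \<open>w'\<close> and \<open>\<tau>\<close> is an involution.\<close>
  have half: "string_ineqs n w (t \<circ> \<tau>)"
    if w: "w = p @ [a, b] @ q" "w' = p @ [b, a] @ q" and ab: "Suc a < b \<or> Suc b < a"
      and str: "string_ineqs n w' t" for w w' a b t
  proof -
    let ?m = "Suc (length p)"
    have len: "length w' = length w" "Suc ?m \<le> length w"
      using w by auto
    have m: "node_wires w ?m = word_perm p ` {a, Suc a}"
      "node_wires w (Suc ?m) = word_perm p ` {b, Suc b}"
      "node_wires w' ?m = word_perm p ` {b, Suc b}"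
      "node_wires w' (Suc ?m) = word_perm p ` {a, Suc a}"
      using ab node_wires_append_right[of 1 p] node_wires_append_right[of 2 p] unfolding w
      by (auto simp: node_wires_Cons_1 node_wires_Cons_Suc numeral_2_eq_2 sw_def)
    have disj: "node_wires w ?m \<inter> node_wires w (Suc ?m) = {}"
      unfolding m using ab by (auto simp: inj_word_perm inj_eq)
    have other: "node_wires w' j = node_wires w j" if j: "j \<noteq> ?m" "j \<noteq> Suc ?m" "1 \<le> j" for j
    proof (cases "j \<le> length p")
      case True
      then show ?thesis
        using j by (simp add: w node_wires_append_left)
    next
      case False
      then obtain i where i: "j = length (p @ [a, b]) + i" "1 \<le> i"
        using j by (intro that[of "j - length (p @ [a, b])"]) auto
      have "word_perm (p @ [a, b]) = word_perm (p @ [b, a])"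
        using ab by (auto simp: word_perm_append fun_eq_iff intro!: arg_cong[of _ _ "word_perm p"] sw_commute)
      then show ?thesis
        using i node_wires_append_right[of i "p @ [a, b]" q] node_wires_append_right[of i "p @ [b, a]" q]
        by (simp add: w)
    qed
    have wires: "node_wires w' (\<tau> j) = node_wires w j" if "j \<in> {1..length w}" for j
      using that m other[of j] by (auto simp: \<tau>_def sw_def)
    have "bij_betw \<tau> {1..length w} {1..length w'}"
      using len unfolding \<tau>_def by (intro bij_betw_byWitness[where f' = "sw ?m"]) (auto simp: sw_def)
    moreover have "\<tau> j < \<tau> j' \<longleftrightarrow> j < j'" if "on_wire w l j" "on_wire w l j'" for j j' l
    proof -
      have "{j, j'} \<noteq> {?m, Suc ?m}"
        using that disj by (auto simp: on_wire_def doubleton_eq_iff)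
      then show ?thesis
        by (auto simp: \<tau>_def sw_def doubleton_eq_iff)
    qed
    ultimately have "rigorous_path w' k (map (\<lambda>(j, a, b). (\<tau> j, a, b)) ps)"
      if "rigorous_path w k ps" for k ps
      using rigorous_path_relabel[OF _ wires _ that] by blast
    then show ?thesis
      using str unfolding string_ineqs_def by (metis string_lhs_relabel)
  qed
  have "t \<circ> \<tau> \<circ> \<tau> = t"
    by (simp add: \<tau>_def fun_eq_iff)
  then show ?thesis
    using half[OF w, of t] half[of w' b a w "t \<circ> \<tau>"] w by auto
qed

text \<open>Reflection sends wire \<open>l\<close> to \<open>n + 2 - l\<close> and \<open>k\<close>
  to \<open>n + 1 - k\<close>. This reverses every orientation, so the image of a path is traversed
  backwards. Reversing names and direction together keeps the sign of each switch, and the two kinds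
  of forbidden passage are interchanged.\<close>

lemma string_ineqs_mirror_le:
  assumes w: "set w \<subseteq> {1..n}" and range: "\<forall>j\<in>{1..length w}. node_wires w j \<subseteq> {1..Suc n}"
    and str: "string_ineqs n (mirror n w) t"
  shows "string_ineqs n w t"
  unfolding string_ineqs_def
proof (intro ballI allI impI)
  fix k ps assume k: "k \<in> {1..n}" and path: "rigorous_path w k ps"
  let ?m = "mirror n w"
  let ?f = "\<lambda>(j, a, b). (j, Suc (Suc n) - b, Suc (Suc n) - a)"
  let ?k = "Suc n - k"
  have on_range: "l \<in> {1..Suc n}" if "on_wire w l j" for l j
    using that bspec[OF range, of j] unfolding on_wire_def by blast
  have on: "on_wire ?m (Suc (Suc n) - l) j \<longleftrightarrow> on_wire w l j" if "l \<in> {1..Suc n}" for l j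
  proof -
    have inj: "inj_on (\<lambda>l. Suc (Suc n) - l) {1..Suc n}"
      by (auto simp: inj_on_def)
    show ?thesis
      using range that inj_on_image_mem_iff[OF inj, of l "node_wires w j"]
      by (auto simp: on_wire_def node_wires_mirror[OF w])
  qed
  have up: "upward ?k (Suc (Suc n) - l) \<longleftrightarrow> \<not> upward k l" if "l \<in> {1..Suc n}" for l
    using k that by (auto simp: upward_def)
  have next_m: "next_node ?m ?k (Suc (Suc n) - l) j' j" if "next_node w k l j j'" for l j j'
  proof -
    have l: "l \<in> {1..Suc n}"
      using that on_range by (auto simp: next_node_def)
    show ?thesis
      using that unfolding next_node_def on[OF l] up[OF l] by (simp split: if_splits)
  qed
  have visit: "visit ?m ?k (?f e)" if "visit w k e" for e
  proof -
    obtain j a b where e: "e = (j, a, b)"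
      by (cases e) auto
    have r: "a \<in> {1..Suc n}" "b \<in> {1..Suc n}" "j \<in> {1..length w}"
      using that on_range by (auto simp: e on_wire_def)
    have "\<not> forbidden_straight ?k (Suc (Suc n) - a) (Suc (Suc n) - c)"
      if c: "a = b" "c \<in> node_wires w j" "Suc (Suc n) - c \<noteq> Suc (Suc n) - a" for c
    proof -
      have c': "c \<in> {1..Suc n}"
        using c(2) r(3) range by blast
      have "\<not> forbidden_straight k a c"
        using \<open>visit w k e\<close> c by (auto simp: e)
      moreover have "Suc (Suc n) - c < Suc (Suc n) - a \<longleftrightarrow> a < c" "Suc (Suc n) - a < Suc (Suc n) - c \<longleftrightarrow> c < a"
        using r(1) c' by auto
      ultimately show ?thesis
        unfolding forbidden_straight_def up[OF r(1)] up[OF c'] by simp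
    qed
    then have "a = b \<longrightarrow> (\<forall>c\<in>node_wires ?m j. c \<noteq> Suc (Suc n) - a \<longrightarrow>
        \<not> forbidden_straight ?k (Suc (Suc n) - a) c)"
      using r(3) by (auto simp: node_wires_mirror[OF w])
    moreover have "Suc (Suc n) - b = Suc (Suc n) - a \<longleftrightarrow> a = b"
      using r by auto
    ultimately show ?thesis
      using \<open>visit w k e\<close> on r by (simp add: e)
  qed
  have ps: "ps \<noteq> []" "distinct (map fst ps)" "\<forall>e\<in>set ps. visit w k e" "start w k (hd ps)"
    "finish w k (last ps)" "successively (link w k) ps"
    using path by (auto simp: rigorous_path_iff)
  have bottom: "bottom_node ?m (Suc (Suc n) - l) j" if "bottom_node w l j" for l j
    using that on_range[of l j] by (auto simp: bottom_node_def on)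
  have "rigorous_path ?m ?k (rev (map ?f ps))"
    unfolding rigorous_path_iff
  proof (intro conjI)
    show "rev (map ?f ps) \<noteq> []"
      using ps(1) by simp
    have "map fst (map ?f ps) = map fst ps"
      by auto
    then show "distinct (map fst (rev (map ?f ps)))"
      using ps(2) by (metis distinct_rev rev_map)
    show "\<forall>e\<in>set (rev (map ?f ps)). visit ?m ?k e"
      using ps(3) visit by auto
    have "start ?m ?k (?f (last ps))"
      using ps(5) k bottom[of "Suc k"] by (cases "last ps") auto
    then show "start ?m ?k (hd (rev (map ?f ps)))"
      using ps(1) by (simp add: hd_rev last_map)
    have "Suc (Suc n) - k = Suc ?k"
      using k by auto
    then have "finish ?m ?k (?f (hd ps))"
      using ps(4) bottom[of k] by (cases "hd ps") auto
    then show "finish ?m ?k (last (rev (map ?f ps)))"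
      using ps(1) by (simp add: last_rev hd_map)
    have "link ?m ?k (?f e') (?f e)" if "link w k e e'" for e e'
      using that next_m by (cases e; cases e') simp
    then show "successively (link ?m ?k) (rev (map ?f ps))"
      unfolding successively_rev successively_map by (intro successively_mono[OF ps(6)])
  qed
  moreover have "?k \<in> {1..n}"
    using k by auto
  ultimately have "string_lhs (rev (map ?f ps)) t \<ge> 0"
    using str unfolding string_ineqs_def by blast
  moreover have "string_lhs (rev (map ?f ps)) t = string_lhs ps t"
    using ps(3)
  proof (induction ps)
    case (Cons e ps)
    obtain j a b where e: "e = (j, a, b)"
      by (cases e) auto
    have "a \<in> {1..Suc n}" "b \<in> {1..Suc n}"
      using Cons.prems on_range by (auto simp: e)
    then have "Suc (Suc n) - b < Suc (Suc n) - a \<longleftrightarrow> a < b" "Suc (Suc n) - a < Suc (Suc n) - b \<longleftrightarrow> b < a"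
      by auto
    then show ?case
      using Cons by (simp add: e)
  qed simp
  ultimately show "string_lhs ps t \<ge> 0"
    by simp
qed

lemma node_wires_range:
  assumes "set w \<subseteq> {1..n}" "j \<in> {1..length w}"
  shows "node_wires w j \<subseteq> {1..Suc n}"
proof -
  have "w ! (j - 1) \<in> set w"
    using assms(2) by auto
  then have "w ! (j - 1) \<in> {1..n}"
    using assms(1) by blast
  moreover have "set (take (j - 1) w) \<subseteq> {1..n}"
    using assms(1) set_take_subset by fast
  ultimately show ?thesis
    using word_perm_range[of "take (j - 1) w" n] unfolding node_wires_def arr_def by auto
qed

lemma string_ineqs_mirror:
  assumes "set w \<subseteq> {1..n}"
  shows "string_ineqs n (mirror n w) t \<longleftrightarrow> string_ineqs n w t"
proof
  have range: "\<forall>j\<in>{1..length v}. node_wires v j \<subseteq> {1..Suc n}" if "set v \<subseteq> {1..n}" for v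
    using node_wires_range[OF that] by blast
  show "string_ineqs n w t" if "string_ineqs n (mirror n w) t"
    using string_ineqs_mirror_le[OF assms range[OF assms] that] .
  show "string_ineqs n (mirror n w) t" if "string_ineqs n w t"
    using string_ineqs_mirror_le[OF set_mirror[OF assms] range[OF set_mirror[OF assms]]] that
    by (simp add: mirror_mirror[OF assms])
qed

subsection \<open>Paths through a final block\<close>

text \<open>Paths depend on a word only through the wires at its nodes, so nothing else is recorded.
  \<open>u\<close> is the contracted diagram on the old wires, and the last \<open>n\<close> nodes
  are their crossings with the new wire \<open>Suc n\<close>.\<close>

locale closing_block =
  fixes u w :: "nat list" and n :: nat
  assumes length_w: "length w = length u + n"
    and prefix: "\<And>j. j \<in> {1..length u} \<Longrightarrow> node_wires w j = node_wires u j"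
    and prefix_sub: "\<And>j. j \<in> {1..length u} \<Longrightarrow> node_wires u j \<subseteq> {1..n}"
    and block: "\<And>i. i \<in> {1..n} \<Longrightarrow> node_wires w (length u + i) = {i, Suc n}"
begin

lemma node_cases:
  assumes "j \<in> {1..length w}"
  obtains "j \<in> {1..length u}" | i where "i \<in> {1..n}" "j = length u + i"
proof (cases "j \<le> length u")
  case False
  with assms length_w show ?thesis
    by (intro that(2)[of "j - length u"]) auto
qed (use assms that(1) in auto)

lemma on_wire_prefix: "j \<le> length u \<Longrightarrow> on_wire w l j \<longleftrightarrow> on_wire u l j"
  using length_w prefix[of j] by (auto simp: on_wire_def)

lemma on_wire_prefix_le: "on_wire u l j \<Longrightarrow> l \<in> {1..n} \<and> j \<le> length u"
  using prefix_sub[of j] unfolding on_wire_def by auto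

lemma on_wire_block: "i \<in> {1..n} \<Longrightarrow> on_wire w l (length u + i) \<longleftrightarrow> l = i \<or> l = Suc n"
  using block[of i] length_w by (auto simp: on_wire_def)

lemma on_wire_old:
  assumes "m \<in> {1..n}"
  shows "on_wire w m j \<longleftrightarrow> on_wire u m j \<or> j = length u + m"
proof
  assume on: "on_wire w m j"
  then have "j \<in> {1..length w}"
    by (simp add: on_wire_def)
  then show "on_wire u m j \<or> j = length u + m"
    by (cases rule: node_cases) (use on assms in \<open>auto simp: on_wire_prefix on_wire_block\<close>)
next
  assume "on_wire u m j \<or> j = length u + m"
  then show "on_wire w m j"
    using assms on_wire_prefix_le[of m j] by (auto simp: on_wire_prefix on_wire_block)
qed

lemma on_wire_new: "on_wire w (Suc n) j \<longleftrightarrow> j \<in> {length u + 1..length u + n}"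
proof
  assume on: "on_wire w (Suc n) j"
  then have "j \<in> {1..length w}"
    by (simp add: on_wire_def)
  then show "j \<in> {length u + 1..length u + n}"
    by (cases rule: node_cases) (use on on_wire_prefix_le[of "Suc n" j] in \<open>auto simp: on_wire_prefix\<close>)
next
  assume "j \<in> {length u + 1..length u + n}"
  then obtain i where "j = length u + i" "i \<in> {1..n}"
    by (intro that[of "j - length u"]) auto
  then show "on_wire w (Suc n) j"
    by (simp add: on_wire_block)
qed

lemma bottom_old:
  assumes m: "m \<in> {1..n}"
  shows "bottom_node w m j \<longleftrightarrow> j = length u + m"
proof -
  have "on_wire u m i \<Longrightarrow> i < length u + m" for i
    using on_wire_prefix_le[of m i] m by auto
  then show ?thesis
    unfolding bottom_node_def on_wire_old[OF m] by (auto dest: less_asym)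
qed

lemma bottom_new: "1 \<le> n \<Longrightarrow> bottom_node w (Suc n) j \<longleftrightarrow> j = length u + n"
  unfolding bottom_node_def on_wire_new by (auto simp: not_le)

lemma next_node_prefix:
  "j \<le> length u \<Longrightarrow> j' \<le> length u \<Longrightarrow> next_node w k l j j' \<longleftrightarrow> next_node u k l j j'"
  by (auto simp: next_node_def on_wire_prefix)

lemma link_prefix:
  "fst e \<le> length u \<Longrightarrow> fst e' \<le> length u \<Longrightarrow> link w k e e' \<longleftrightarrow> link u k e e'"
  by (cases e; cases e') (simp add: next_node_prefix)

text \<open>Together with \<open>next_node_down\<close>: the block node of an old wire stands for
  its end point in the diagram of \<open>u\<close>, so paths enter and leave \<open>u\<close>
  exactly at the ends of wires.\<close>

lemma next_node_up:
  assumes "m \<in> {1..n}" "upward k m"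
  shows "next_node w k m (length u + m) j \<longleftrightarrow> bottom_node u m j"
  using assms on_wire_prefix_le[of m]
  by (fastforce simp: next_node_def bottom_node_def on_wire_old)

lemma next_node_down:
  assumes "m \<in> {1..n}" "\<not> upward k m" "j \<le> length u"
  shows "next_node w k m j (length u + m) \<longleftrightarrow> bottom_node u m j"
  using assms on_wire_prefix_le[of m]
  by (fastforce simp: next_node_def bottom_node_def on_wire_old)

lemma next_node_down_end:
  assumes "m \<in> {1..n}" "\<not> upward k m"
  shows "\<not> next_node w k m (length u + m) j"
  using assms on_wire_prefix_le[of m j] by (auto simp: next_node_def on_wire_old)

text \<open>For \<open>k \<le> n\<close> the new wire points downward and so runs through the block
  nodes from first to last.\<close>

lemma next_node_new:
  assumes "i \<in> {1..n}" "k \<le> n"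
  shows "next_node w k (Suc n) (length u + i) j \<longleftrightarrow> i < n \<and> j = length u + Suc i"
proof
  assume next_ij: "next_node w k (Suc n) (length u + i) j"
  then have j: "on_wire w (Suc n) j" "length u + i < j"
    "\<forall>j''. length u + i < j'' \<and> j'' < j \<longrightarrow> \<not> on_wire w (Suc n) j''"
    using assms(2) by (auto simp: next_node_def upward_def)
  then have "\<not> length u + Suc i < j"
    using spec[OF j(3), of "length u + Suc i"] by (auto simp: on_wire_new)
  with j show "i < n \<and> j = length u + Suc i"
    by (auto simp: on_wire_new)
qed (use assms in \<open>auto simp: next_node_def upward_def on_wire_new\<close>)

text \<open>On the new wire, going straight through the crossing with another downward wire is forbidden.\<close>

lemma visit_new:
  assumes "i \<in> {1..n}" "k < i" "visit w k (length u + i, Suc n, b)"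
  shows "b = i"
  using assms block[OF assms(1)]
  by (auto simp: on_wire_block forbidden_straight_def upward_def)

text \<open>At its first node the path either switches to the new wire, which it must leave at the
  next node unless it ends there, or goes straight into \<open>u\<close>. In the latter case it
  comes back on a downward wire, which can only be \<open>k + 1\<close>.\<close>

lemma path_cases:
  assumes k: "k \<in> {1..n}" and path: "rigorous_path w k ps"
  obtains "k = n" "ps = [(length u + n, n, Suc n)]"
  | "k < n" "ps = [(length u + k, k, Suc n), (length u + Suc k, Suc n, Suc k)]"
  | qs where "k < n" "rigorous_path u k qs"
      "ps = (length u + k, k, k) # qs @ [(length u + Suc k, Suc k, Suc k)]"
proof -
  let ?L = "length u"
  have ps: "ps \<noteq> []" "distinct (map fst ps)" "\<forall>e\<in>set ps. visit w k e" "start w k (hd ps)"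
    "finish w k (last ps)" "successively (link w k) ps"
    using path by (auto simp: rigorous_path_iff)
  then obtain b0 rest where rest: "ps = (?L + k, k, b0) # rest"
    using k by (cases ps) (auto simp: bottom_old)
  have up_k: "upward k k"
    by (simp add: upward_def)
  have b0: "b0 = k \<or> b0 = Suc n"
    using ps(3) k by (simp add: rest on_wire_block)
  show ?thesis
  proof (cases "b0 = Suc n")
    case True
    show ?thesis
    proof (cases rest)
      case Nil
      then have "k = n"
        using ps(5) True by (simp add: rest)
      then show ?thesis
        using that(1) Nil True rest by simp
    next
      case (Cons e rest')
      obtain j1 a1 b1 where e: "e = (j1, a1, b1)"
        by (cases e) auto
      have "a1 = Suc n \<and> k < n \<and> j1 = ?L + Suc k"
        using ps(6) k True by (simp add: rest Cons e next_node_new)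
      then have 1: "a1 = Suc n" "k < n" "j1 = ?L + Suc k"
        by auto
      have b1: "b1 = Suc k"
        using visit_new[of "Suc k" k b1] ps(3) 1 by (simp add: rest Cons e)
      \<comment> \<open>Wire \<open>k + 1\<close> points downward and has no node below its block
        node.\<close>
      have "rest' = []"
      proof (rule ccontr)
        assume "rest' \<noteq> []"
        then obtain j2 where "next_node w k (Suc k) (?L + Suc k) j2"
          using ps(6) 1 b1 by (cases rest') (auto simp: rest Cons e)
        then show False
          using next_node_down_end[of "Suc k" k j2] 1 by (simp add: upward_def)
      qed
      then show ?thesis
        using that(2) 1 b1 True by (simp add: rest Cons e)
    qed
  next
    case False
    with b0 k have [simp]: "b0 = k"
      by simp
    define qs where "qs = takeWhile (\<lambda>e. fst e \<le> ?L) rest"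
    define ts where "ts = dropWhile (\<lambda>e. fst e \<le> ?L) rest"
    have split: "rest = qs @ ts"
      by (simp add: qs_def ts_def)
    have qs: "fst e \<le> ?L" if "e \<in> set qs" for e
      using that set_takeWhileD unfolding qs_def by metis
    \<comment> \<open>The path ends at the bottom node of wire \<open>k + 1\<close>, which lies in
      the block, so it has to return from \<open>u\<close>.\<close>
    have "ts \<noteq> []"
    proof
      assume "ts = []"
      then have "fst (last ps) \<le> ?L \<or> rest = []"
        using qs[of "last qs"] by (auto simp: rest split)
      moreover have "?L < fst (last ps)"
        using ps(5) k bottom_old[of "Suc k"] bottom_new
        by (cases "last ps"; cases "k = n") auto
      ultimately show False
        using ps(5) by (simp add: rest)
    qed
    then obtain jr ar br ts' where ts: "ts = (jr, ar, br) # ts'"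
      by (cases ts) auto
    have jr: "\<not> jr \<le> ?L"
      using \<open>ts \<noteq> []\<close> hd_dropWhile[of "\<lambda>e. fst e \<le> ?L" rest] ts by (simp add: ts_def)
    obtain j1 b1 rest' where r1: "rest = (j1, k, b1) # rest'" and next1: "next_node w k k (?L + k) j1"
    proof -
      have "rest \<noteq> []"
        using ts split by simp
      then obtain e rest' where "rest = e # rest'"
        by (meson neq_Nil_conv)
      then show ?thesis
        using that ps(6) by (cases e) (simp add: rest)
    qed
    have bottom1: "bottom_node u k j1"
      using next1 k up_k by (simp add: next_node_up)
    then have "j1 \<le> ?L"
      using on_wire_prefix_le by (auto simp: bottom_node_def)
    then obtain qs' where qs': "qs = (j1, k, b1) # qs'"
      by (auto simp: qs_def r1)
    then obtain j a m where last: "last qs = (j, a, m)"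
      by (cases "last qs") auto
    have mem: "(j, a, m) \<in> set qs"
      using last qs' by (metis last_in_set list.distinct(1))
    have j: "j \<le> ?L"
      using qs[OF mem] by simp
    have m: "m \<in> {1..n}"
    proof -
      have "visit w k (j, a, m)"
        using mem by (intro bspec[OF ps(3)]) (simp add: rest split)
      then show ?thesis
        using j on_wire_prefix_le by (auto simp: on_wire_prefix)
    qed
    have "successively (link w k) (qs @ ts)"
      using ps(6) by (auto simp: rest split successively_Cons)
    then have succ: "successively (link w k) qs" "successively (link w k) ts"
      "link w k (last qs) (hd ts)"
      using \<open>ts \<noteq> []\<close> qs' unfolding successively_append_iff by auto
    then have "ar = m" and next_m: "next_node w k m j jr"
      by (auto simp: last ts)
    have "on_wire w m jr"
      using next_m by (simp add: next_node_def)
    then have jr_eq: "jr = ?L + m"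
      using jr on_wire_prefix_le m by (auto simp: on_wire_old)
    \<comment> \<open>The path passes from \<open>u\<close> into the block, that is, to a larger
      node number.\<close>
    have down: "\<not> upward k m"
      using next_m j jr by (auto simp: next_node_def)
    have br: "br = m \<or> br = Suc n"
      using ps(3) m by (auto simp: rest split ts jr_eq on_wire_block)
    have last_ps: "last ps = last ts"
      by (simp add: rest split ts)
    \<comment> \<open>Switching to the new wire at the crossing with \<open>m\<close> would force
      the path onto wire \<open>m + 1\<close> and end it there; since \<open>m > k\<close>, that is
      not wire \<open>k + 1\<close>.\<close>
    have ts': "ts' = []"
    proof (rule ccontr)
      assume "ts' \<noteq> []"
      then obtain j2 a2 b2 ts'' where ts': "ts' = (j2, a2, b2) # ts''"
        by (cases ts') auto
      then have next2: "a2 = br" "next_node w k br jr j2"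
        using succ(2) by (auto simp: ts)
      then have "br = Suc n"
        using br next_node_down_end[OF m down, of j2] jr_eq by auto
      then have 2: "m < n" "j2 = ?L + Suc m"
        using next2 next_node_new[OF m, of k j2] k jr_eq by auto
      have b2: "b2 = Suc m"
        using visit_new[of "Suc m" k b2] ps(3) next2 2 down \<open>br = Suc n\<close>
        by (simp add: rest split ts ts' upward_def)
      have "ts'' = []"
      proof (rule ccontr)
        assume "ts'' \<noteq> []"
        then obtain j3 where "next_node w k (Suc m) (?L + Suc m) j3"
          using succ(2) 2 b2 by (cases ts'') (auto simp: ts ts')
        then show False
          using next_node_down_end[of "Suc m" k j3] 2 down by (simp add: upward_def)
      qed
      then show False
        using ps(5) b2 down by (simp add: last_ps ts ts' upward_def)
    qed
    then have "br = Suc k"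
      using ps(5) by (simp add: last_ps ts)
    \<comment> \<open>The alternative \<open>br = Suc n\<close> would give \<open>k = n\<close>,
      leaving no old wire that points downward.\<close>
    then have mk: "m = Suc k" "k < n"
      using br down m by (auto simp: upward_def)
    have "rigorous_path u k qs"
      unfolding rigorous_path_iff
    proof (intro conjI ballI)
      show "qs \<noteq> []"
        by (simp add: qs')
      show "distinct (map fst qs)"
        using ps(2) by (simp add: rest split)
      show "start u k (hd qs)"
        using bottom1 by (simp add: qs')
      show "finish u k (last qs)"
        using next_m next_node_down[OF m down j] by (simp add: last mk(1)[symmetric] jr_eq)
      show "successively (link u k) qs"
      proof (rule successively_mono[OF succ(1)])
        fix e e' assume "e \<in> set qs" "e' \<in> set qs" "link w k e e'"
        then show "link u k e e'"
          using qs link_prefix by blast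
      qed
    next
      fix e assume e: "e \<in> set qs"
      then have "visit w k e"
        using ps(3) by (simp add: rest split)
      then show "visit u k e"
        using qs[OF e] prefix[of "fst e"] length_w
        by (cases e) (auto simp: on_wire_prefix on_wire_def)
    qed
    then show ?thesis
      using that(3) mk \<open>br = Suc k\<close> \<open>ar = m\<close> ts' by (simp add: rest split ts jr_eq)
  qed
qed

lemma rigorous_path_extend:
  assumes k: "k \<in> {1..n}" "k < n" and path: "rigorous_path u k qs"
  shows "rigorous_path w k ((length u + k, k, k) # qs @ [(length u + Suc k, Suc k, Suc k)])"
proof -
  let ?L = "length u"
  have qs: "qs \<noteq> []" "distinct (map fst qs)" "\<forall>e\<in>set qs. visit u k e" "start u k (hd qs)"
    "finish u k (last qs)" "successively (link u k) qs"
    using path by (auto simp: rigorous_path_iff)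
  have le: "fst e \<le> ?L" if "e \<in> set qs" for e
    using bspec[OF qs(3) that] on_wire_prefix_le by (cases e) auto
  have notin: "?L + i \<notin> fst ` set qs" if "1 \<le> i" for i
    using le that by fastforce
  have "visit w k e" if "e \<in> set qs" for e
    using bspec[OF qs(3) that] le[OF that] prefix[of "fst e"] length_w
    by (cases e) (auto simp: on_wire_prefix on_wire_def)
  \<comment> \<open>Straight passage is allowed at both ends: at the first node the orientations
    differ, and at the last the path is on the smaller of two downward wires.\<close>
  moreover have "visit w k (?L + k, k, k)" "visit w k (?L + Suc k, Suc k, Suc k)"
    using k block[of k] block[of "Suc k"] on_wire_block[of "Suc k"]
    by (auto simp: on_wire_block forbidden_straight_def upward_def)
  moreover have "successively (link w k) qs"
  proof (rule successively_mono[OF qs(6)])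
    fix e e' assume "e \<in> set qs" "e' \<in> set qs" "link u k e e'"
    then show "link w k e e'"
      using le link_prefix by blast
  qed
  moreover have "link w k (?L + k, k, k) (hd qs)"
    using qs(4) k next_node_up[of k k] by (cases "hd qs") (simp add: upward_def)
  moreover have "link w k (last qs) (?L + Suc k, Suc k, Suc k)"
    using qs(5) k next_node_down[of "Suc k" k] le[OF last_in_set[OF qs(1)]]
    by (cases "last qs") (auto simp: upward_def)
  ultimately show ?thesis
    using qs(1,2) k notin[of k] notin[of "Suc k"] unfolding rigorous_path_iff
    by (auto simp: successively_append_iff successively_Cons bottom_old)
qed

text \<open>In \<open>path_cases\<close> the first kind of path gives the last inequality of the
  chain and the second kind its differences. In the third kind both block nodes are passed straight
  with coefficient 0, so the inequality of the inner path remains.\<close>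

lemma string_ineqs_block:
  "string_ineqs n w t \<longleftrightarrow> string_ineqs (n - 1) u t \<and>
    (\<forall>i\<in>{1..n}. (if i < n then t (length u + Suc i) else 0) \<le> t (length u + i))"
  (is "?W \<longleftrightarrow> ?U \<and> ?C")
proof (intro iffI conjI)
  assume str: ?W
  show ?U
    unfolding string_ineqs_def
  proof (intro ballI allI impI)
    fix k qs assume "k \<in> {1..n - 1}" "rigorous_path u k qs"
    then have "k \<in> {1..n}" and path: "rigorous_path w k ((length u + k, k, k) # qs @ [(length u + Suc k, Suc k, Suc k)])"
      using rigorous_path_extend[of k qs] by auto
    then show "0 \<le> string_lhs qs t"
      using str unfolding string_ineqs_def by fastforce
  qed
  show ?C
  proof
    fix i assume i: "i \<in> {1..n}"
    show "(if i < n then t (length u + Suc i) else 0) \<le> t (length u + i)"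
    proof (cases "i < n")
      case True
      have "rigorous_path w i [(length u + i, i, Suc n), (length u + Suc i, Suc n, Suc i)]"
        unfolding rigorous_path_iff using i True
        using on_wire_block[of "Suc i"] by (auto simp: on_wire_block bottom_old next_node_new)
      then show ?thesis
        using str i True unfolding string_ineqs_def by fastforce
    next
      case False
      then have "rigorous_path w i [(length u + i, i, Suc n)]"
        unfolding rigorous_path_iff using i
        by (auto simp: on_wire_block bottom_old bottom_new)
      then show ?thesis
        using str i False unfolding string_ineqs_def by fastforce
    qed
  qed
next
  assume "?U \<and> ?C"
  then have str: ?U and chain: ?C
    by auto
  show ?W
    unfolding string_ineqs_def
  proof (intro ballI allI impI)
    fix k ps assume k: "k \<in> {1..n}" and "rigorous_path w k ps"
    then show "0 \<le> string_lhs ps t"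
    proof (cases rule: path_cases)
      case 1
      then show ?thesis
        using bspec[OF chain k] by simp
    next
      case 2
      then show ?thesis
        using bspec[OF chain k] by simp
    next
      case (3 qs)
      then show ?thesis
        using bspec[OF str[unfolded string_ineqs_def], of k] k by auto
    qed
  qed
qed

end

subsection \<open>Weight inequalities\<close>

definition lam_ineqs :: "nat list \<Rightarrow> (nat \<Rightarrow> real) \<Rightarrow> (nat \<Rightarrow> real) \<Rightarrow> bool" where
  "lam_ineqs w lam t \<longleftrightarrow>
     (\<forall>j\<in>{1..length w}. t j \<le> lam (w ! (j - 1)) + (\<Sum>k\<in>{j<..length w}. lam_coef w j k * t k))"

text \<open>Minus the Cartan matrix of type A, indexed by letters rather than nodes.\<close>

definition letter_coef :: "nat \<Rightarrow> nat \<Rightarrow> real" where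
  "letter_coef a b = (if b = a then -2 else if b = Suc a \<or> a = Suc b then 1 else 0)"

lemma lam_coef_eq: "lam_coef w j k = letter_coef (w ! (j - 1)) (w ! (k - 1))"
  by (simp add: lam_coef_def letter_coef_def Let_def)

lemma letter_coef_pred: "a \<noteq> 0 \<Longrightarrow> b \<noteq> 0 \<Longrightarrow> letter_coef (a - 1) (b - 1) = letter_coef a b"
  by (cases a; cases b) (auto simp: letter_coef_def)

lemma lam_ineqs_cong:
  assumes "\<And>i. i \<in> set w \<Longrightarrow> lam i = lam' i"
  shows "lam_ineqs w lam t \<longleftrightarrow> lam_ineqs w lam' t"
proof -
  have "lam (w ! (j - 1)) = lam' (w ! (j - 1))" if "j \<in> {1..length w}" for j
    using that by (intro assms) auto
  then show ?thesis
    by (simp add: lam_ineqs_def)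
qed

text \<open>The two exchanged letters have coefficient 0 against each other, so it does not matter
  which of their nodes comes later.\<close>

lemma lam_ineqs_two_move:
  assumes w: "w = p @ [a, b] @ q" "w' = p @ [b, a] @ q" "Suc a < b \<or> Suc b < a"
  defines "\<tau> \<equiv> sw (Suc (length p))"
  shows "lam_ineqs w' lam t \<longleftrightarrow> lam_ineqs w lam (t \<circ> \<tau>)"
proof -
  have half: "lam_ineqs w lam (t \<circ> \<tau>)"
    if w: "w = p @ [a, b] @ q" "w' = p @ [b, a] @ q" and ab: "Suc a < b \<or> Suc b < a"
      and ineqs: "lam_ineqs w' lam t" for w w' a b t
    unfolding lam_ineqs_def
  proof
    let ?m = "Suc (length p)"
    let ?I = "{1..length w}"
    fix j assume j: "j \<in> ?I"
    have len: "length w' = length w" "Suc ?m \<le> length w"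
      using w by auto
    have range: "\<tau> k \<in> ?I" if "k \<in> ?I" for k
      using that len by (auto simp: \<tau>_def sw_def)
    have nth: "w' ! (\<tau> k - 1) = w ! (k - 1)" if "k \<in> ?I" for k
      using that by (cases k) (auto simp: \<tau>_def sw_def w nth_append nth_Cons' split: if_splits)
    have nth_m: "w ! (?m - 1) = a" "w ! (Suc ?m - 1) = b"
      by (auto simp: w nth_append)
    \<comment> \<open>Written as a sum over all nodes with a condition, the sum over later nodes can
      be reindexed by \<open>\<tau>\<close>.\<close>
    have sum_if: "(\<Sum>k\<in>{j<..length w}. f k) = (\<Sum>k\<in>?I. if j < k then f k else 0)"
      for f :: "nat \<Rightarrow> real" and j
      by (simp add: sum.If_cases) (rule sum.cong; auto)
    have terms: "(if \<tau> j < \<tau> k then lam_coef w' (\<tau> j) (\<tau> k) * t (\<tau> k) else 0) =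
        (if j < k then lam_coef w j k * t (\<tau> k) else 0)" if k: "k \<in> ?I" for k
    proof (cases "{j, k} = {?m, Suc ?m}")
      case True
      then have "lam_coef w j k = 0"
        using ab nth_m unfolding lam_coef_eq letter_coef_def by (auto simp: doubleton_eq_iff)
      then show ?thesis
        unfolding lam_coef_eq nth[OF j] nth[OF k] by simp
    next
      case False
      then have "\<tau> j < \<tau> k \<longleftrightarrow> j < k"
        by (auto simp: \<tau>_def sw_def doubleton_eq_iff)
      then show ?thesis
        unfolding lam_coef_eq nth[OF j] nth[OF k] by simp
    qed
    have "t (\<tau> j) \<le> lam (w' ! (\<tau> j - 1)) + (\<Sum>k\<in>{\<tau> j<..length w'}. lam_coef w' (\<tau> j) k * t k)"
      using ineqs range[OF j] unfolding lam_ineqs_def len by blast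
    also have "(\<Sum>k\<in>{\<tau> j<..length w'}. lam_coef w' (\<tau> j) k * t k) =
        (\<Sum>k\<in>?I. if \<tau> j < k then lam_coef w' (\<tau> j) k * t k else 0)"
      unfolding len by (rule sum_if)
    also have "\<dots> = (\<Sum>k\<in>?I. if \<tau> j < \<tau> k then lam_coef w' (\<tau> j) (\<tau> k) * t (\<tau> k) else 0)"
      using range by (intro sum.reindex_bij_witness[of _ \<tau> \<tau>]) (auto simp: \<tau>_def)
    also have "\<dots> = (\<Sum>k\<in>?I. if j < k then lam_coef w j k * t (\<tau> k) else 0)"
      by (intro sum.cong refl terms)
    also have "\<dots> = (\<Sum>k\<in>{j<..length w}. lam_coef w j k * t (\<tau> k))"
      by (rule sum_if[symmetric])
    finally show "(t \<circ> \<tau>) j \<le> lam (w ! (j - 1)) + (\<Sum>k\<in>{j<..length w}. lam_coef w j k * (t \<circ> \<tau>) k)"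
      using nth[OF j] by simp
  qed
  have "t \<circ> \<tau> \<circ> \<tau> = t"
    by (simp add: \<tau>_def fun_eq_iff)
  then show ?thesis
    using half[OF w, of t] half[of w' b a w "t \<circ> \<tau>"] w by auto
qed

text \<open>For a node of \<open>u\<close> the terms from \<open>v\<close> depend only on its
  letter. They replace the weight by \<open>lam\<close> minus the combination of the simple roots of
  the letters of \<open>v\<close> with coefficients \<open>t\<close>.\<close>

lemma lam_ineqs_append:
  "lam_ineqs (u @ v) lam t \<longleftrightarrow> lam_ineqs v lam (\<lambda>k. t (length u + k)) \<and>
     lam_ineqs u (\<lambda>i. lam i + (\<Sum>k\<in>{1..length v}. letter_coef i (v ! (k - 1)) * t (length u + k))) t"
  (is "_ \<longleftrightarrow> _ \<and> lam_ineqs u ?lam' t")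
proof -
  let ?L = "length u"
  have nth_v: "(u @ v) ! (?L + k - 1) = v ! (k - 1)" if "1 \<le> k" for k
    using that by (cases k) (auto simp: nth_append)
  have nth_u: "(u @ v) ! (k - 1) = u ! (k - 1)" if "k \<in> {1..?L}" for k
    using that by (cases k) (auto simp: nth_append)
  let ?P = "\<lambda>j. t j \<le> lam ((u @ v) ! (j - 1)) +
    (\<Sum>k\<in>{j<..length (u @ v)}. lam_coef (u @ v) j k * t k)"
  have shift: "(\<Sum>k\<in>{?L + j<..?L + m}. f k) = (\<Sum>k\<in>{j<..m}. f (?L + k))" for j m and f :: "nat \<Rightarrow> real"
    by (rule sum.reindex_bij_witness[of _ "\<lambda>k. ?L + k" "\<lambda>k. k - ?L"]) auto
  have v: "?P (?L + j) \<longleftrightarrow> t (?L + j) \<le> lam (v ! (j - 1)) +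
      (\<Sum>k\<in>{j<..length v}. lam_coef v j k * t (?L + k))" if "j \<in> {1..length v}" for j
  proof -
    have "(\<Sum>k\<in>{?L + j<..length (u @ v)}. lam_coef (u @ v) (?L + j) k * t k) =
        (\<Sum>k\<in>{j<..length v}. lam_coef v j k * t (?L + k))"
      unfolding length_append shift
    proof (intro sum.cong refl)
      fix k assume "k \<in> {j<..length v}"
      then have "1 \<le> k" "1 \<le> j"
        using that by auto
      then show "lam_coef (u @ v) (?L + j) (?L + k) * t (?L + k) = lam_coef v j k * t (?L + k)"
        by (simp only: lam_coef_eq nth_v)
    qed
    then show ?thesis
      using that by (simp only: nth_v atLeastAtMost_iff)
  qed
  have u: "?P j \<longleftrightarrow> t j \<le> ?lam' (u ! (j - 1)) + (\<Sum>k\<in>{j<..?L}. lam_coef u j k * t k)"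
    if j: "j \<in> {1..?L}" for j
  proof -
    have "(\<Sum>k\<in>{j<..length (u @ v)}. lam_coef (u @ v) j k * t k) =
        (\<Sum>k\<in>{j<..?L}. lam_coef (u @ v) j k * t k) +
        (\<Sum>k\<in>{?L + 0<..?L + length v}. lam_coef (u @ v) j k * t k)"
      using j by (subst sum.union_disjoint[symmetric]) (auto intro!: sum.cong)
    also have "(\<Sum>k\<in>{j<..?L}. lam_coef (u @ v) j k * t k) = (\<Sum>k\<in>{j<..?L}. lam_coef u j k * t k)"
      using nth_u j by (intro sum.cong) (auto simp: lam_coef_eq)
    also have "(\<Sum>k\<in>{?L + 0<..?L + length v}. lam_coef (u @ v) j k * t k) =
        (\<Sum>k\<in>{1..length v}. letter_coef (u ! (j - 1)) (v ! (k - 1)) * t (?L + k))"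
      unfolding shift
    proof (intro sum.cong)
      show "{0<..length v} = {1..length v}"
        by auto
    qed (simp only: lam_coef_eq nth_u[OF j] nth_v atLeastAtMost_iff)
    finally show ?thesis
      using nth_u[OF j] by (simp add: algebra_simps)
  qed
  have "{1..length (u @ v)} = {1..?L} \<union> (\<lambda>j. ?L + j) ` {1..length v}"
  proof (intro equalityI subsetI)
    fix j assume "j \<in> {1..length (u @ v)}"
    then show "j \<in> {1..?L} \<union> (\<lambda>j. ?L + j) ` {1..length v}"
      by (cases "j \<le> ?L") (auto intro!: image_eqI[of _ _ "j - ?L"])
  qed auto
  then have "lam_ineqs (u @ v) lam t \<longleftrightarrow>
      (\<forall>j\<in>{1..?L}. ?P j) \<and> (\<forall>j\<in>{1..length v}. ?P (?L + j))"
    unfolding lam_ineqs_def by (simp only: ball_Un ball_simps)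
  also have "\<dots> \<longleftrightarrow> lam_ineqs u ?lam' t \<and> lam_ineqs v lam (\<lambda>k. t (?L + k))"
    unfolding lam_ineqs_def using u v by (intro arg_cong2[of _ _ _ _ "(\<and>)"] ball_cong refl)
  finally show ?thesis
    by blast
qed

lemma lam_ineqs_pred:
  assumes "0 \<notin> set u"
  shows "lam_ineqs (map (\<lambda>x. x - 1) u) lam t \<longleftrightarrow> lam_ineqs u (\<lambda>i. lam (i - 1)) t"
proof -
  have pos: "u ! (j - 1) \<noteq> 0" if "j \<in> {1..length u}" for j
  proof -
    have "u ! (j - 1) \<in> set u"
      using that by auto
    then show ?thesis
      using assms by metis
  qed
  have nth: "map (\<lambda>x. x - 1) u ! (j - 1) = u ! (j - 1) - 1" if "j \<in> {1..length u}" for j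
    using that by (cases j) auto
  have "lam_coef (map (\<lambda>x. x - 1) u) j k = lam_coef u j k"
    if "j \<in> {1..length u}" "k \<in> {1..length u}" for j k
    unfolding lam_coef_eq nth[OF that(1)] nth[OF that(2)]
    using pos[OF that(1)] pos[OF that(2)] by (rule letter_coef_pred)
  then have "(\<Sum>k\<in>{j<..length u}. lam_coef (map (\<lambda>x. x - 1) u) j k * t k) =
      (\<Sum>k\<in>{j<..length u}. lam_coef u j k * t k)" if "j \<in> {1..length u}" for j
    using that by (intro sum.cong) auto
  note sum = this
  show ?thesis
    unfolding lam_ineqs_def length_map by (intro ball_cong refl) (simp only: nth sum)
qed

text \<open>\<open>block_pos s m\<close> is the involution relating letters and nodes of a block: node \<open>i\<close> carries
  letter \<open>block_pos s m i\<close>.\<close>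

fun block_pos :: "AD \<Rightarrow> nat \<Rightarrow> nat \<Rightarrow> nat" where
  "block_pos D m i = Suc m - i"
| "block_pos A m i = i"

lemma block_nth: "i \<in> {1..m} \<Longrightarrow> block s m ! (i - 1) = block_pos s m i"
  by (cases s) (auto simp: block_D_nth block_A_nth)

lemma block_pos_range: "i \<in> {1..m} \<Longrightarrow> block_pos s m i \<in> {1..m}"
  by (cases s) auto

lemma block_pos_invol: "i \<in> {1..m} \<Longrightarrow> block_pos s m (block_pos s m i) = i"
  by (cases s) auto

lemma ball_block_pos: "(\<forall>i\<in>{1..m}. P (block_pos s m i)) \<longleftrightarrow> (\<forall>i\<in>{1..m}. P i)"
proof (intro iffI ballI)
  fix i assume "\<forall>i\<in>{1..m}. P (block_pos s m i)" and i: "i \<in> {1..m}"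
  then have "P (block_pos s m (block_pos s m i))"
    using block_pos_range[OF i] by blast
  then show "P i"
    by (simp add: block_pos_invol[OF i])
qed (use block_pos_range in blast)

text \<open>The letters of a block are distinct and monotone by steps of 1, so among the later nodes
  only the next one carries an adjacent letter.\<close>

lemma lam_ineqs_block:
  "lam_ineqs (block s m) lam t \<longleftrightarrow>
     (\<forall>i\<in>{1..m}. t i \<le> lam (block_pos s m i) + (if i < m then t (Suc i) else 0))"
proof -
  have sum: "(\<Sum>k\<in>{i<..m}. lam_coef (block s m) i k * t k) = (if i < m then t (Suc i) else 0)"
    if i: "i \<in> {1..m}" for i
  proof -
    have "lam_coef (block s m) i k * t k = (if k = Suc i then t (Suc i) else 0)"
      if k: "k \<in> {i<..m}" for k
    proof -
      have "k \<in> {1..m}"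
        using i k by auto
      then show ?thesis
        using i k unfolding lam_coef_eq block_nth[OF i] block_nth[OF \<open>k \<in> {1..m}\<close>]
        by (cases s) (auto simp: letter_coef_def)
    qed
    then have "(\<Sum>k\<in>{i<..m}. lam_coef (block s m) i k * t k) =
        (\<Sum>k\<in>{i<..m}. if k = Suc i then t (Suc i) else 0)"
      by (intro sum.cong) auto
    also have "\<dots> = (if i < m then t (Suc i) else 0)"
      by (simp add: sum.delta)
    finally show ?thesis .
  qed
  then show ?thesis
    unfolding lam_ineqs_def length_block by (intro ball_cong refl) (simp only: block_nth sum)
qed

lemma block_coef_sum:
  assumes i: "i \<in> {1..m}"
  shows "(\<Sum>k\<in>{1..m}. letter_coef i (block s m ! (k - 1)) * t k) =
    (if 1 < i then t (block_pos s m (i - 1)) else 0) - 2 * t (block_pos s m i) +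
    (if i < m then t (block_pos s m (Suc i)) else 0)"
proof -
  let ?a = "\<lambda>i. t (block_pos s m i)"
  have "(\<Sum>k\<in>{1..m}. letter_coef i (block s m ! (k - 1)) * t k) =
      (\<Sum>k\<in>{1..m}. letter_coef i k * ?a k)"
    by (rule sum.reindex_bij_witness[of _ "block_pos s m" "block_pos s m"])
      (simp_all only: block_nth block_pos_range block_pos_invol)
  \<comment> \<open>Only the neighbouring letters survive. For \<open>i = 1\<close> and
    \<open>i = m\<close> one of them falls outside the range, which gives the value 0 at the
    ends.\<close>
  also have "\<dots> = (\<Sum>k\<in>{1..m}. (if k = i - 1 then ?a k else 0) + (if k = i then - 2 * ?a k else 0) +
      (if k = Suc i then ?a k else 0))"
    using i by (intro sum.cong) (auto simp: letter_coef_def)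
  also have "\<dots> = (if 1 < i then ?a (i - 1) else 0) - 2 * ?a i + (if i < m then ?a (Suc i) else 0)"
    using i by (auto simp: sum.distrib sum.delta)
  finally show ?thesis .
qed

section \<open>Gelfand-Cetlin rows and charts\<close>

text \<open>Computes a row of length \<open>k\<close> from the row \<open>r\<close> above it.
  \<open>D\<close> measures each entry down from its upper bound \<open>r j\<close>,
  \<open>A\<close> up from its lower bound \<open>r (Suc j)\<close>; coordinates beyond the ends of
  the block count as 0.\<close>

definition row_step :: "AD \<Rightarrow> nat \<Rightarrow> (nat \<Rightarrow> real) \<Rightarrow> (nat \<Rightarrow> real) \<Rightarrow> nat \<Rightarrow> real" where
  "row_step s k r a j =
     (if s = D then r j - a j + (if 1 < j then a (j - 1) else 0)
      else r (Suc j) + a j - (if j < k then a (Suc j) else 0))"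

definition rows :: "(nat \<Rightarrow> AD) \<Rightarrow> nat \<Rightarrow> (nat \<Rightarrow> nat \<Rightarrow> real) \<Rightarrow> (nat \<Rightarrow> nat \<Rightarrow> real) \<Rightarrow> bool" where
  "rows \<sigma> n a X \<longleftrightarrow> (\<forall>k\<in>{1..n}. \<forall>j\<in>{1..k}. X k j = row_step (\<sigma> k) k (X (Suc k)) (a k) j)"

definition interlacing :: "nat \<Rightarrow> (nat \<Rightarrow> nat \<Rightarrow> real) \<Rightarrow> bool" where
  "interlacing n X \<longleftrightarrow> (\<forall>k\<in>{1..n}. \<forall>j\<in>{1..k}. X k j \<le> X (Suc k) j \<and> X (Suc k) (Suc j) \<le> X k j)"

lemma interlacing_Suc:
  "interlacing (Suc n) X \<longleftrightarrow> interlacing n X \<and>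
     (\<forall>j\<in>{1..Suc n}. X (Suc n) j \<le> X (Suc (Suc n)) j \<and> X (Suc (Suc n)) (Suc j) \<le> X (Suc n) j)"
  unfolding interlacing_def by (subst atLeastAtMostSuc_conv) (simp, blast)

text \<open>The invariant of the induction. The top row of \<open>X\<close> stays free and real,
  because after a contraction the weight depends on the coordinates of the removed block;
  \<open>\<pi>\<close> is chosen before \<open>t\<close> and \<open>X\<close>.\<close>

definition gc_chart :: "(nat \<Rightarrow> AD) \<Rightarrow> nat \<Rightarrow> nat list \<Rightarrow> (nat \<times> nat \<Rightarrow> nat) \<Rightarrow> bool" where
  "gc_chart \<sigma> n w \<pi> \<longleftrightarrow> bij_betw \<pi> (gc_index n) {1..length w} \<and>
     (\<forall>t X. rows \<sigma> n (\<lambda>k j. t (\<pi> (k, j))) X \<longrightarrow>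
        (string_ineqs n w t \<and> lam_ineqs w (\<lambda>i. X (Suc n) i - X (Suc n) (Suc i)) t
          \<longleftrightarrow> interlacing n X))"

lemma gc_chart_two_move:
  assumes "two_move w w'" "gc_chart \<sigma> n w' \<pi>"
  shows "\<exists>\<pi>. gc_chart \<sigma> n w \<pi>"
proof -
  obtain p q a b where w: "w = p @ [a, b] @ q" "w' = p @ [b, a] @ q" "Suc a < b \<or> Suc b < a"
    using assms(1) by (auto simp: two_move_def)
  define \<tau> where "\<tau> = sw (Suc (length p))"
  have "bij_betw \<tau> {1..length w'} {1..length w}"
    using w unfolding \<tau>_def by (intro bij_betw_byWitness[where f' = "sw (Suc (length p))"]) (auto simp: sw_def)
  then have bij: "bij_betw (\<tau> \<circ> \<pi>) (gc_index n) {1..length w}"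
    using assms(2) bij_betw_trans unfolding gc_chart_def by blast
  have "string_ineqs n w t \<and> lam_ineqs w (\<lambda>i. X (Suc n) i - X (Suc n) (Suc i)) t \<longleftrightarrow> interlacing n X"
    if "rows \<sigma> n (\<lambda>k j. t ((\<tau> \<circ> \<pi>) (k, j))) X" for t X
  proof -
    have \<tau>\<tau>: "t \<circ> \<tau> \<circ> \<tau> = t"
      by (simp add: \<tau>_def fun_eq_iff)
    have "rows \<sigma> n (\<lambda>k j. (t \<circ> \<tau>) (\<pi> (k, j))) X"
      using that by (simp add: comp_def)
    then have "string_ineqs n w' (t \<circ> \<tau>) \<and>
        lam_ineqs w' (\<lambda>i. X (Suc n) i - X (Suc n) (Suc i)) (t \<circ> \<tau>) \<longleftrightarrow> interlacing n X"
      using assms(2) unfolding gc_chart_def by blast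
    then show ?thesis
      unfolding string_ineqs_two_move[OF w, folded \<tau>_def] lam_ineqs_two_move[OF w, folded \<tau>_def] \<tau>\<tau> .
  qed
  with bij show ?thesis
    unfolding gc_chart_def by blast
qed

lemma gc_chart_word_equiv:
  assumes "word_equiv w w'" "\<exists>\<pi>. gc_chart \<sigma> n w' \<pi>"
  shows "\<exists>\<pi>. gc_chart \<sigma> n w \<pi>"
  using assms unfolding word_equiv_def
  by (induction rule: converse_rtranclp_induct) (use gc_chart_two_move in blast)+

text \<open>The equivalence holds node by node. For \<open>D\<close> the string inequality is the
  upper bound on the entry and the weight inequality the lower one; for \<open>A\<close> the roles
  are exchanged.\<close>

lemma block_ineqs_interlace:
  assumes X: "\<forall>j\<in>{1..m}. x j = row_step s m r (\<lambda>j. t (block_pos s m j)) j"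
  shows "(\<forall>i\<in>{1..m}. (if i < m then t (Suc i) else 0) \<le> t i) \<and>
      lam_ineqs (block s m) (\<lambda>i. r i - r (Suc i)) t \<longleftrightarrow>
    (\<forall>j\<in>{1..m}. x j \<le> r j \<and> r (Suc j) \<le> x j)"
proof -
  have step: "(if i < m then t (Suc i) else 0) \<le> t i \<and>
      t i \<le> r (block_pos s m i) - r (Suc (block_pos s m i)) + (if i < m then t (Suc i) else 0) \<longleftrightarrow>
      x (block_pos s m i) \<le> r (block_pos s m i) \<and> r (Suc (block_pos s m i)) \<le> x (block_pos s m i)"
    if i: "i \<in> {1..m}" for i
  proof (cases s)
    case A
    then show ?thesis
      using X i by (auto simp: row_step_def)
  next
    case D
    have "x (Suc m - i) = r (Suc m - i) - t i + (if i < m then t (Suc i) else 0)"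
      using X i D by (auto simp: row_step_def Suc_diff_le)
    then show ?thesis
      using D by auto
  qed
  show ?thesis
    unfolding lam_ineqs_block ball_conj_distrib[symmetric]
    by (subst ball_block_pos[of m _ s, symmetric]) (intro ball_cong refl step)
qed

text \<open>Gaps of the new row are second differences of the block coordinates added to gaps of
  \<open>r\<close>. For \<open>A\<close> the letter \<open>i\<close> is still unshifted and becomes
  \<open>i - 1\<close> in the contraction, hence the gap with index \<open>i - 1\<close>.\<close>

lemma contracted_weight:
  assumes X: "\<forall>j\<in>{1..m}. x j = row_step s m r (\<lambda>j. t (block_pos s m j)) j"
    and i: "i \<in> {1..m}" "s = D \<Longrightarrow> i < m" "s = A \<Longrightarrow> 1 < i"
  shows "r i - r (Suc i) + (\<Sum>k\<in>{1..m}. letter_coef i (block s m ! (k - 1)) * t k) =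
    (if s = D then x i - x (Suc i) else x (i - 1) - x i)"
proof (cases s)
  case A
  then have "i - 1 \<in> {1..m}"
    using i by auto
  with X have "x (i - 1) = row_step s m r (\<lambda>j. t (block_pos s m j)) (i - 1)" ..
  then show ?thesis
    using X i A unfolding block_coef_sum[OF i(1)] by (auto simp: row_step_def)
next
  case D
  then have "x (Suc i) = row_step s m r (\<lambda>j. t (block_pos s m j)) (Suc i)"
    using X i by auto
  then show ?thesis
    using X i D unfolding block_coef_sum[OF i(1)] by (auto simp: row_step_def)
qed

text \<open>For \<open>A\<close> the whole word is reflected, the descending block is removed, and
  the remainder is reflected back in rank \<open>n\<close>. Reflection keeps node numbers, so the
  chain of block inequalities is the same.\<close>

lemma string_ineqs_split:
  assumes "red_w0 (Suc n) (u @ block s (Suc n))"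
  shows "string_ineqs (Suc n) (u @ block s (Suc n)) t \<longleftrightarrow>
    string_ineqs n (if s = D then u else map (\<lambda>x. x - 1) u) t \<and>
    (\<forall>i\<in>{1..Suc n}. (if i < Suc n then t (length u + Suc i) else 0) \<le> t (length u + i))"
proof -
  have block_D: "string_ineqs (Suc n) (v @ block D (Suc n)) t \<longleftrightarrow> string_ineqs n v t \<and>
      (\<forall>i\<in>{1..Suc n}. (if i < Suc n then t (length v + Suc i) else 0) \<le> t (length v + i))"
    if red: "red_w0 (Suc n) (v @ block D (Suc n))" for v
  proof -
    have "closing_block v (v @ block D (Suc n)) (Suc n)"
      using red_w0_split_D(2,3)[OF red] by unfold_locales (auto simp: node_wires_append_left)
    from closing_block.string_ineqs_block[OF this] show ?thesis
      by simp
  qed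
  show ?thesis
  proof (cases s)
    case D
    then show ?thesis
      using block_D assms by simp
  next
    case A
    let ?v = "mirror (Suc n) u"
    have red: "red_w0 (Suc n) (u @ block A (Suc n))"
      using assms A by simp
    note split = red_w0_split_A[OF red]
    have "set (u @ block A (Suc n)) \<subseteq> {1..Suc n}"
      using red by (simp add: red_w0_def)
    from string_ineqs_mirror[OF this, of t]
    have "string_ineqs (Suc n) (u @ block A (Suc n)) t \<longleftrightarrow> string_ineqs (Suc n) (?v @ block D (Suc n)) t"
      by (simp add: mirror_block_A)
    moreover have "set ?v \<subseteq> {1..n}"
      using red_w0_split_D(1)[OF split(3)] by (simp add: red_w0_def)
    from string_ineqs_mirror[OF this, of t]
    have "string_ineqs n ?v t \<longleftrightarrow> string_ineqs n (map (\<lambda>x. x - 1) u) t"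
      by (simp add: split(4))
    ultimately show ?thesis
      using block_D[OF split(3)] A by simp
  qed
qed

text \<open>Inductive step: the string, weight and interlacing conditions each split into a part for
  the block and a part for \<open>v\<close>, for which row \<open>n + 1\<close> serves as the top
  row.\<close>

lemma gc_chart_block:
  fixes u s n
  defines "v \<equiv> if s = D then u else map (\<lambda>x. x - 1) u"
  assumes red: "red_w0 (Suc n) (u @ block s (Suc n))" and s: "\<sigma> (Suc n) = s"
    and chart: "gc_chart \<sigma> n v \<pi>"
  shows "\<exists>\<pi>. gc_chart \<sigma> (Suc n) (u @ block s (Suc n)) \<pi>"
proof -
  let ?m = "Suc n"
  let ?w = "u @ block s ?m"
  \<comment> \<open>Entry \<open>j\<close> of the row just below the top goes to the block node with
    letter \<open>j\<close>.\<close>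
  define \<pi>' where "\<pi>' p = (if fst p = ?m then length u + block_pos s ?m (snd p) else \<pi> p)" for p
  have len: "length v = length u"
    by (simp add: v_def)
  have bij: "bij_betw \<pi>' (gc_index ?m) {1..length ?w}"
  proof -
    have "\<pi>' p = \<pi> p" if "p \<in> gc_index n" for p
      using that by (auto simp: gc_index_def \<pi>'_def)
    moreover have "bij_betw \<pi> (gc_index n) {1..length u}"
      using chart len by (simp add: gc_chart_def)
    ultimately have "bij_betw \<pi>' (gc_index n) {1..length u}"
      using bij_betw_cong[of "gc_index n" \<pi>' \<pi>] by simp
    moreover have "bij_betw \<pi>' (Pair ?m ` {1..?m}) {length u + 1..length u + ?m}"
    proof (rule bij_betw_byWitness[where f' = "\<lambda>i. (?m, block_pos s ?m (i - length u))"])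
      show "\<pi>' ` Pair ?m ` {1..?m} \<subseteq> {length u + 1..length u + ?m}"
      proof
        fix i assume "i \<in> \<pi>' ` Pair ?m ` {1..?m}"
        then obtain j where j: "j \<in> {1..?m}" "i = length u + block_pos s ?m j"
          by (auto simp: \<pi>'_def)
        then show "i \<in> {length u + 1..length u + ?m}"
          using block_pos_range[OF j(1), of s] by simp
      qed
      show "(\<lambda>i. (?m, block_pos s ?m (i - length u))) ` {length u + 1..length u + ?m} \<subseteq> Pair ?m ` {1..?m}"
      proof
        fix p assume "p \<in> (\<lambda>i. (?m, block_pos s ?m (i - length u))) ` {length u + 1..length u + ?m}"
        then obtain i where i: "i \<in> {length u + 1..length u + ?m}"
          "p = (?m, block_pos s ?m (i - length u))"
          by blast
        then have "i - length u \<in> {1..?m}"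
          by auto
        then show "p \<in> Pair ?m ` {1..?m}"
          using block_pos_range[of "i - length u" ?m s] i(2) by blast
      qed
      show "\<forall>i\<in>{length u + 1..length u + ?m}. \<pi>' (?m, block_pos s ?m (i - length u)) = i"
      proof
        fix i assume i: "i \<in> {length u + 1..length u + ?m}"
        then have "i - length u \<in> {1..?m}"
          by auto
        then show "\<pi>' (?m, block_pos s ?m (i - length u)) = i"
          using i by (simp only: \<pi>'_def fst_conv snd_conv block_pos_invol) simp
      qed
      show "\<forall>p\<in>Pair ?m ` {1..?m}. (?m, block_pos s ?m (\<pi>' p - length u)) = p"
      proof
        fix p assume "p \<in> Pair ?m ` {1..?m}"
        then obtain j where "p = (?m, j)" "j \<in> {1..?m}"
          by blast
        then show "(?m, block_pos s ?m (\<pi>' p - length u)) = p"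
          by (simp only: \<pi>'_def fst_conv snd_conv simp_thms if_True diff_add_inverse block_pos_invol)
      qed
    qed
    ultimately have "bij_betw \<pi>' (gc_index n \<union> Pair ?m ` {1..?m})
        ({1..length u} \<union> {length u + 1..length u + ?m})"
      by (rule bij_betw_combine) auto
    moreover have "gc_index n \<union> Pair ?m ` {1..?m} = gc_index ?m"
      by (auto simp: gc_index_def le_Suc_eq image_iff)
    moreover have "{1..length u} \<union> {length u + 1..length u + ?m} = {1..length ?w}"
      by auto
    ultimately show ?thesis
      by simp
  qed
  have "string_ineqs ?m ?w t \<and> lam_ineqs ?w (\<lambda>i. X (Suc ?m) i - X (Suc ?m) (Suc i)) t \<longleftrightarrow>
      interlacing ?m X" if rows: "rows \<sigma> ?m (\<lambda>k j. t (\<pi>' (k, j))) X" for t X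
  proof -
    let ?t = "\<lambda>k. t (length u + k)"
    let ?r = "X (Suc ?m)"
    have top: "\<forall>j\<in>{1..?m}. X ?m j = row_step s ?m ?r (\<lambda>j. ?t (block_pos s ?m j)) j"
      using rows s by (simp add: rows_def \<pi>'_def)
    have "rows \<sigma> n (\<lambda>k j. t (\<pi> (k, j))) X"
      using rows by (auto simp: rows_def \<pi>'_def)
    then have IH: "string_ineqs n v t \<and> lam_ineqs v (\<lambda>i. X ?m i - X ?m (Suc i)) t \<longleftrightarrow> interlacing n X"
      using chart unfolding gc_chart_def by blast
    \<comment> \<open>The remaining letters avoid \<open>n + 1\<close> for \<open>D\<close> and 1
      for \<open>A\<close>, exactly the letters that \<open>contracted_weight\<close>
      excludes.\<close>
    have set_D: "set u \<subseteq> {1..n}" if "s = D"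
      using red_w0_split_D(1)[of n u] red that by (simp add: red_w0_def)
    have set_A: "set u \<subseteq> {2..?m}" if "s = A"
      using red_w0_split_A(1)[of n u] red that by simp
    have weight: "?r i - ?r (Suc i) +
        (\<Sum>k\<in>{1..length (block s ?m)}. letter_coef i (block s ?m ! (k - 1)) * t (length u + k)) =
        (if s = D then X ?m i - X ?m (Suc i) else X ?m (i - 1) - X ?m i)" if "i \<in> set u" for i
      unfolding length_block
      by (rule contracted_weight[OF top]) (use that set_D set_A in \<open>cases s; fastforce\<close>)+
    have "lam_ineqs v (\<lambda>i. X ?m i - X ?m (Suc i)) t \<longleftrightarrow>
        lam_ineqs u (\<lambda>i. if s = D then X ?m i - X ?m (Suc i) else X ?m (i - 1) - X ?m i) t"
    proof (cases s)
      case A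
      then have "0 \<notin> set u"
        using set_A by auto
      from lam_ineqs_pred[OF this] show ?thesis
        using A set_A by (auto simp: v_def intro!: lam_ineqs_cong)
    qed (simp add: v_def)
    also have "\<dots> \<longleftrightarrow> lam_ineqs u (\<lambda>i. ?r i - ?r (Suc i) +
        (\<Sum>k\<in>{1..length (block s ?m)}. letter_coef i (block s ?m ! (k - 1)) * t (length u + k))) t"
      using weight by (intro lam_ineqs_cong) simp
    finally have "string_ineqs ?m ?w t \<and> lam_ineqs ?w (\<lambda>i. ?r i - ?r (Suc i)) t \<longleftrightarrow>
        (string_ineqs n v t \<and> lam_ineqs v (\<lambda>i. X ?m i - X ?m (Suc i)) t) \<and>
        (\<forall>j\<in>{1..?m}. X ?m j \<le> ?r j \<and> ?r (Suc j) \<le> X ?m j)"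
      unfolding string_ineqs_split[OF red] lam_ineqs_append block_ineqs_interlace[OF top, symmetric] v_def
      by blast
    also have "\<dots> \<longleftrightarrow> interlacing ?m X"
      unfolding IH interlacing_Suc by blast
    finally show ?thesis .
  qed
  with bij show ?thesis
    unfolding gc_chart_def by blast
qed

section \<open>Induction along the contractions\<close>

text \<open>The recursion of \<open>iter_contr\<close> appends the last contraction, whereas the
  induction on the rank has to split off the first.\<close>

lemma iter_contr_Suc:
  "iter_contr \<sigma> (Suc n) w (Suc d) = iter_contr \<sigma> n (contr (\<sigma> (Suc n)) (Suc n) w) d"
  by (induction d) auto

lemma ex_gc_chart:
  assumes "red_w0 n w" "\<forall>k\<in>{1..n}. ind (\<sigma> k) k (iter_contr \<sigma> n w (n - k)) = 0"
  shows "\<exists>\<pi>. gc_chart \<sigma> n w \<pi>"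
  using assms
proof (induction n arbitrary: w)
  case 0
  have "gc_index 0 = {}"
    by (auto simp: gc_index_def)
  with 0 show ?case
    by (auto simp: gc_chart_def red_w0_def Nn_def string_ineqs_def lam_ineqs_def
        interlacing_def bij_betw_def)
next
  case (Suc n)
  let ?s = "\<sigma> (Suc n)"
  let ?u = "fst (decomp ?s (Suc n) w)"
  let ?v = "contr ?s (Suc n) w"
  have "ind ?s (Suc n) w = 0"
    using Suc.prems(2) by (force dest: bspec[of _ _ "Suc n"])
  then have equiv: "word_equiv w (?u @ block ?s (Suc n))" and "snd (decomp ?s (Suc n) w) = []"
    using word_equiv_decomp[OF Suc.prems(1)] by (auto simp: ind_def)
  \<comment> \<open>With an empty second component the chosen contraction is literally the word that
    \<open>gc_chart_block\<close> expects, not merely equivalent to it.\<close>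
  then have v: "?v = (if ?s = D then ?u else map (\<lambda>x. x - 1) ?u)"
    by (cases ?s) auto
  have red: "red_w0 (Suc n) (?u @ block ?s (Suc n))"
    using word_equiv_red_w0[OF equiv Suc.prems(1)] .
  then have "red_w0 n ?v"
    unfolding v by (cases ?s) (auto dest: red_w0_split_D(1) red_w0_split_A(2))
  moreover have "ind (\<sigma> k) k (iter_contr \<sigma> n ?v (n - k)) = 0" if "k \<in> {1..n}" for k
  proof -
    have "Suc n - k = Suc (n - k)"
      using that by auto
    then show ?thesis
      using Suc.prems(2) that by (force simp: iter_contr_Suc[symmetric] dest: bspec[of _ _ k])
  qed
  ultimately have "\<exists>\<pi>. gc_chart \<sigma> n ?v \<pi>"
    using Suc.IH by blast
  then show ?case
    using gc_chart_word_equiv[OF equiv] gc_chart_block[where \<sigma> = \<sigma>, OF red refl] unfolding v by blast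
qed

subsection \<open>Unimodular equivalence\<close>

text \<open>The identity is demanded for all \<open>x\<close>, so \<open>f\<close> depends only on
  the coordinates in \<open>I\<close>.\<close>

definition int_affine :: "'a set \<Rightarrow> (('a \<Rightarrow> real) \<Rightarrow> real) \<Rightarrow> bool" where
  "int_affine I f \<longleftrightarrow> (\<exists>(m :: 'a \<Rightarrow> int) (v :: int).
     \<forall>x. f x = (\<Sum>a\<in>I. real_of_int (m a) * x a) + real_of_int v)"

lemma int_affine_const: "int_affine I (\<lambda>x. real_of_int c)"
  unfolding int_affine_def by (intro exI[of _ "\<lambda>_. 0"] exI[of _ c]) simp

lemma int_affine_coord:
  assumes "finite I" "a \<in> I"
  shows "int_affine I (\<lambda>x. x a)"
proof -
  have "x a = (\<Sum>b\<in>I. real_of_int (if b = a then 1 else 0) * x b) + real_of_int 0" for x :: "'a \<Rightarrow> real"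
  proof -
    have "(\<Sum>b\<in>I. real_of_int (if b = a then 1 else 0) * x b) = (\<Sum>b\<in>I. if b = a then x a else 0)"
      by (rule sum.cong) auto
    then show ?thesis
      using assms by (simp add: sum.delta)
  qed
  then show ?thesis
    unfolding int_affine_def
    by (intro exI[of _ "\<lambda>b. if b = a then 1 else 0"] exI[of _ 0] allI)
qed

lemma int_affine_add:
  assumes "int_affine I f" "int_affine I g"
  shows "int_affine I (\<lambda>x. f x + g x)"
proof -
  obtain m v m' v' where "\<forall>x. f x = (\<Sum>a\<in>I. real_of_int (m a) * x a) + real_of_int v"
    "\<forall>x. g x = (\<Sum>a\<in>I. real_of_int (m' a) * x a) + real_of_int v'"
    using assms unfolding int_affine_def by blast
  then show ?thesis
    unfolding int_affine_def
    by (intro exI[of _ "\<lambda>a. m a + m' a"] exI[of _ "v + v'"]) (simp add: sum.distrib distrib_right)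
qed

lemma int_affine_uminus:
  assumes "int_affine I f"
  shows "int_affine I (\<lambda>x. - f x)"
proof -
  obtain m v where "\<forall>x. f x = (\<Sum>a\<in>I. real_of_int (m a) * x a) + real_of_int v"
    using assms unfolding int_affine_def by blast
  then show ?thesis
    unfolding int_affine_def
    by (intro exI[of _ "\<lambda>a. - m a"] exI[of _ "- v"]) (simp add: sum_negf)
qed

lemma int_affine_diff:
  "int_affine I f \<Longrightarrow> int_affine I g \<Longrightarrow> int_affine I (\<lambda>x. f x - g x)"
  using int_affine_add[of I f "\<lambda>x. - g x"] int_affine_uminus[of I g] by simp

lemma int_affine_sum:
  "(\<And>i. i \<in> S \<Longrightarrow> int_affine I (f i)) \<Longrightarrow> int_affine I (\<lambda>x. \<Sum>i\<in>S. f i x)"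
proof (induction S rule: infinite_finite_induct)
  case (insert i S)
  then show ?case
    by (simp add: int_affine_add)
qed (use int_affine_const[of I 0] in simp_all)

text \<open>Evaluating the composite at a unit vector and at 0 and subtracting removes the
  translations and leaves an entry of the matrix product.\<close>

lemma matrix_inverse_of_affine_inverse:
  fixes M :: "'b \<Rightarrow> 'a \<Rightarrow> int" and M' :: "'a \<Rightarrow> 'b \<Rightarrow> int"
  assumes fin: "finite I" and "a' \<in> I"
    and inv: "\<And>t :: 'a \<Rightarrow> real. (\<Sum>b\<in>J. real_of_int (M' a b) *
        ((\<Sum>a''\<in>I. real_of_int (M b a'') * t a'') + real_of_int (v b))) + real_of_int c = t a"
  shows "(\<Sum>b\<in>J. M' a b * M b a') = (if a = a' then 1 else 0)"
proof -
  let ?\<delta> = "\<lambda>a''. if a'' = a' then 1 else (0 :: real)"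
  have "(\<Sum>a''\<in>I. real_of_int (M b a'') * ?\<delta> a'') = real_of_int (M b a')" for b
  proof -
    have "(\<Sum>a''\<in>I. real_of_int (M b a'') * ?\<delta> a'') =
        (\<Sum>a''\<in>I. if a'' = a' then real_of_int (M b a') else 0)"
      by (rule sum.cong) auto
    then show ?thesis
      using assms by (simp add: sum.delta)
  qed
  then have "(\<Sum>b\<in>J. real_of_int (M' a b) * (real_of_int (M b a') + real_of_int (v b))) + real_of_int c =
      ?\<delta> a"
    using inv[of ?\<delta>] by simp
  moreover have "(\<Sum>b\<in>J. real_of_int (M' a b) * real_of_int (v b)) + real_of_int c = 0"
    using inv[of "\<lambda>_. 0"] by simp
  ultimately have "(\<Sum>b\<in>J. real_of_int (M' a b) * real_of_int (M b a')) = ?\<delta> a"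
    by (simp add: distrib_left sum.distrib)
  then have "real_of_int (\<Sum>b\<in>J. M' a b * M b a') = real_of_int (if a = a' then 1 else 0)"
    by simp
  then show ?thesis
    by (simp only: of_int_eq_iff)
qed

text \<open>Two mutually inverse integral affine maps have mutually inverse integer matrices as
  linear parts, so unimodularity needs no determinant.\<close>

lemma unimod_equivI:
  fixes F :: "('a \<Rightarrow> real) \<Rightarrow> 'b \<Rightarrow> real" and G :: "('b \<Rightarrow> real) \<Rightarrow> 'a \<Rightarrow> real"
  assumes fin: "finite I" "finite J"
    and F: "\<And>b. b \<in> J \<Longrightarrow> int_affine I (\<lambda>t. F t b)"
    and G: "\<And>a. a \<in> I \<Longrightarrow> int_affine J (\<lambda>x. G x a)"
    and GF: "\<And>t a. a \<in> I \<Longrightarrow> G (F t) a = t a"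
    and FG: "\<And>x b. b \<in> J \<Longrightarrow> F (G x) b = x b"
    and pq: "\<And>t. p t \<longleftrightarrow> q (\<lambda>b. if b \<in> J then F t b else 0)"
  shows "unimod_equiv I J {t. (\<forall>a. a \<notin> I \<longrightarrow> t a = 0) \<and> p t} {x. (\<forall>b. b \<notin> J \<longrightarrow> x b = 0) \<and> q x}"
    (is "unimod_equiv I J ?P ?Q")
proof -
  have "\<forall>b. \<exists>m v. b \<in> J \<longrightarrow> (\<forall>t. F t b = (\<Sum>a\<in>I. real_of_int (m a) * t a) + real_of_int v)"
    using F unfolding int_affine_def by blast
  then obtain M v where F_eq: "\<And>b t. b \<in> J \<Longrightarrow> F t b = (\<Sum>a\<in>I. real_of_int (M b a) * t a) + real_of_int (v b)"
    by metis
  have "\<forall>a. \<exists>m v. a \<in> I \<longrightarrow> (\<forall>x. G x a = (\<Sum>b\<in>J. real_of_int (m b) * x b) + real_of_int v)"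
    using G unfolding int_affine_def by blast
  then obtain M' v' where G_eq: "\<And>a x. a \<in> I \<Longrightarrow> G x a = (\<Sum>b\<in>J. real_of_int (M' a b) * x b) + real_of_int (v' a)"
    by metis
  have inv1: "(\<Sum>b\<in>J. M' a b * M b a') = (if a = a' then 1 else 0)" if "a \<in> I" "a' \<in> I" for a a'
  proof (rule matrix_inverse_of_affine_inverse[OF fin(1) that(2)])
    fix t
    show "(\<Sum>b\<in>J. real_of_int (M' a b) *
        ((\<Sum>a''\<in>I. real_of_int (M b a'') * t a'') + real_of_int (v b))) + real_of_int (v' a) = t a"
      using GF[OF that(1), of t] by (simp add: G_eq[OF that(1)] F_eq)
  qed
  have inv2: "(\<Sum>a\<in>I. M b a * M' a b') = (if b = b' then 1 else 0)" if "b \<in> J" "b' \<in> J" for b b'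
  proof (rule matrix_inverse_of_affine_inverse[OF fin(2) that(2)])
    fix x
    show "(\<Sum>a\<in>I. real_of_int (M b a) *
        ((\<Sum>b''\<in>J. real_of_int (M' a b'') * x b'') + real_of_int (v' a))) + real_of_int (v b) = x b"
      using FG[OF that(1), of x] by (simp add: G_eq F_eq[OF that(1)])
  qed
  let ?F = "\<lambda>t b. if b \<in> J then F t b else 0"
  have image: "?F ` ?P = ?Q"
  proof (intro equalityI subsetI)
    fix x assume "x \<in> ?F ` ?P"
    then show "x \<in> ?Q"
      using pq by auto
  next
    fix x assume x: "x \<in> ?Q"
    \<comment> \<open>Cutting \<open>G x\<close> off outside \<open>I\<close> puts it into the
      ambient space and leaves \<open>F\<close> unchanged, as \<open>F\<close> reads only
      coordinates in \<open>I\<close>.\<close>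
    define t where "t a = (if a \<in> I then G x a else 0)" for a
    have "F t b = x b" if "b \<in> J" for b
      using FG[OF that, of x] by (simp add: F_eq[OF that] t_def)
    then have "?F t = x"
      using x by auto
    moreover have "t \<in> ?P"
      using pq[of t] x \<open>?F t = x\<close> by (simp add: t_def)
    ultimately show "x \<in> ?F ` ?P"
      by (metis (mono_tags, lifting) image_eqI)
  qed
  have F_matrix: "?F = (\<lambda>t b. if b \<in> J then (\<Sum>a\<in>I. real_of_int (M b a) * t a) + real_of_int (v b) else 0)"
    by (auto simp: F_eq fun_eq_iff)
  show ?thesis
    unfolding unimod_equiv_def
    by (intro exI[of _ M] exI[of _ M'] exI[of _ v] conjI ballI inv1 inv2 image[unfolded F_matrix])
qed

text \<open>Recovers the block coordinates from consecutive rows by telescoping.\<close>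

definition gc_coord :: "(nat \<Rightarrow> AD) \<Rightarrow> (nat \<Rightarrow> nat \<Rightarrow> real) \<Rightarrow> nat \<Rightarrow> nat \<Rightarrow> real" where
  "gc_coord \<sigma> X k j =
     (if \<sigma> k = D then \<Sum>i\<in>{1..j}. X (Suc k) i - X k i else \<Sum>i\<in>{j..k}. X k i - X (Suc k) (Suc i))"

lemma gc_coord_rows:
  assumes rows: "rows \<sigma> n a X" and k: "k \<in> {1..n}" and j: "j \<in> {1..k}"
  shows "gc_coord \<sigma> X k j = a k j"
proof (cases "\<sigma> k")
  case A
  have "j \<le> k"
    using j by simp
  then have "(\<Sum>i\<in>{j..k}. X k i - X (Suc k) (Suc i)) = a k j" if "1 \<le> j"
    using that
  proof (induction rule: inc_induct)
    case base
    then show ?case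
      using rows k A by (simp add: rows_def row_step_def)
  next
    case (step i)
    then have "{i..k} = insert i {Suc i..k}"
      by auto
    then show ?case
      using step rows k A by (simp add: rows_def row_step_def)
  qed
  then show ?thesis
    using A j by (simp add: gc_coord_def)
next
  case D
  have "(\<Sum>i\<in>{1..j}. X (Suc k) i - X k i) = (if j = 0 then 0 else a k j)" if "j \<le> k" for j
    using that
  proof (induction j)
    case (Suc j)
    then show ?case
      using rows k D by (simp add: rows_def row_step_def)
  qed simp
  then show ?thesis
    using D j by (simp add: gc_coord_def)
qed

text \<open>With \<open>gc_coord_rows\<close> and \<open>rows_unique\<close>, this makes rows below
  a fixed top row and block coordinates determine each other, as both composites in
  \<open>unimod_equivI\<close> require.\<close>

lemma rows_gc_coord: "rows \<sigma> n (gc_coord \<sigma> X) X"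
  unfolding rows_def
proof (intro ballI)
  fix k j assume k: "k \<in> {1..n}" and j: "j \<in> {1..k}"
  show "X k j = row_step (\<sigma> k) k (X (Suc k)) (gc_coord \<sigma> X k) j"
  proof (cases "\<sigma> k")
    case A
    have "{j..k} = insert j {Suc j..k}"
      using j by auto
    then show ?thesis
      using A j by (auto simp: row_step_def gc_coord_def)
  next
    case D
    obtain i where "j = Suc i"
      using j by (cases j) auto
    then show ?thesis
      using D by (auto simp: row_step_def gc_coord_def)
  qed
qed

lemma rows_cong:
  assumes "\<And>k j. k \<in> {1..n} \<Longrightarrow> j \<in> {1..k} \<Longrightarrow> a k j = a' k j"
  shows "rows \<sigma> n a X \<longleftrightarrow> rows \<sigma> n a' X"
proof -
  have "a k (j - 1) = a' k (j - 1)" if "k \<in> {1..n}" "j \<in> {1..k}" "1 < j" for k j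
    using that by (intro assms) auto
  then have "row_step (\<sigma> k) k r (a k) j = row_step (\<sigma> k) k r (a' k) j" if "k \<in> {1..n}" "j \<in> {1..k}" for k j r
    using that by (auto simp: row_step_def assms)
  then show ?thesis
    by (simp add: rows_def)
qed

lemma interlacing_cong:
  assumes "\<And>k j. k \<in> {1..Suc n} \<Longrightarrow> j \<in> {1..k} \<Longrightarrow> X k j = X' k j"
  shows "interlacing n X \<longleftrightarrow> interlacing n X'"
  unfolding interlacing_def using assms by (intro ball_cong refl) auto

text \<open>Each row is computed from the row above, so agreement propagates downward from the
  top.\<close>

lemma rows_unique:
  assumes "rows \<sigma> n a X" "rows \<sigma> n a X'" "\<And>j. X (Suc n) j = X' (Suc n) j"
    and "k \<in> {1..Suc n}" "j \<in> {1..k}"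
  shows "X k j = X' k j"
proof -
  have "k \<le> Suc n"
    using assms(4) by simp
  then have "1 \<le> k \<longrightarrow> (\<forall>j\<in>{1..k}. X k j = X' k j)"
  proof (induction rule: inc_induct)
    case base
    then show ?case
      using assms(3) by simp
  next
    case (step k)
    show ?case
    proof (intro impI ballI)
      fix j assume k: "1 \<le> k" and j: "j \<in> {1..k}"
      then have "X (Suc k) j = X' (Suc k) j" "X (Suc k) (Suc j) = X' (Suc k) (Suc j)"
        using step.IH by auto
      moreover have "k \<in> {1..n}"
        using k step.hyps by simp
      ultimately show "X k j = X' k j"
        using assms(1,2) j by (simp add: rows_def row_step_def)
    qed
  qed
  then show ?thesis
    using assms(4,5) by simp
qed

text \<open>\<open>gc_row \<sigma> n a r d\<close> is the row of index \<open>n + 1 - d\<close> below the top row \<open>r\<close>.\<close>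

primrec gc_row :: "(nat \<Rightarrow> AD) \<Rightarrow> nat \<Rightarrow> (nat \<Rightarrow> nat \<Rightarrow> real) \<Rightarrow> (nat \<Rightarrow> real) \<Rightarrow> nat \<Rightarrow> nat \<Rightarrow> real" where
  "gc_row \<sigma> n a r 0 = r"
| "gc_row \<sigma> n a r (Suc d) = row_step (\<sigma> (n - d)) (n - d) (gc_row \<sigma> n a r d) (a (n - d))"

lemma rows_gc_row: "rows \<sigma> n a (\<lambda>k. gc_row \<sigma> n a r (Suc n - k))"
  unfolding rows_def
proof (intro ballI)
  fix k j assume "k \<in> {1..n}"
  then have "Suc n - k = Suc (n - k)" "n - (n - k) = k" "Suc n - Suc k = n - k"
    by auto
  then show "gc_row \<sigma> n a r (Suc n - k) j =
      row_step (\<sigma> k) k (gc_row \<sigma> n a r (Suc n - Suc k)) (a k) j"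
    by (simp only: gc_row.simps)
qed

lemma int_affine_gc_row:
  assumes "finite I" "\<pi> ` gc_index n \<subseteq> I"
  shows "d \<le> n \<Longrightarrow> j \<in> {1..Suc n - d} \<Longrightarrow>
    int_affine I (\<lambda>t. gc_row \<sigma> n (\<lambda>k j. t (\<pi> (k, j))) (\<lambda>j. real_of_int (r j)) d j)"
proof (induction d arbitrary: j)
  case 0
  show ?case
    by (simp add: int_affine_const)
next
  case (Suc d)
  let ?R = "\<lambda>t. gc_row \<sigma> n (\<lambda>k j. t (\<pi> (k, j))) (\<lambda>j. real_of_int (r j)) d"
  let ?k = "n - d"
  have row: "int_affine I (\<lambda>t. ?R t j)" "int_affine I (\<lambda>t. ?R t (Suc j))"
    using Suc.prems by (auto intro!: Suc.IH)
  have coord: "int_affine I (\<lambda>t. t (\<pi> (?k, i)))" if "i \<in> {1..?k}" for i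
    using assms that Suc.prems(1) by (intro int_affine_coord) (auto simp: gc_index_def)
  have j: "j \<in> {1..?k}"
    using Suc.prems by auto
  have zero: "int_affine I (\<lambda>t. 0)"
    using int_affine_const[of I 0] by simp
  have left: "int_affine I (\<lambda>t. if 1 < j then t (\<pi> (?k, j - 1)) else 0)"
  proof (cases "1 < j")
    case True
    then have "j - 1 \<in> {1..?k}"
      using j by auto
    from coord[OF this] True show ?thesis
      by simp
  qed (simp add: zero)
  have right: "int_affine I (\<lambda>t. if j < ?k then t (\<pi> (?k, Suc j)) else 0)"
    using coord[of "Suc j"] zero j by (cases "j < ?k") auto
  show ?case
  proof (cases "\<sigma> ?k = D")
    case True
    then show ?thesis
      by (simp only: gc_row.simps row_step_def True simp_thms if_True)
        (intro int_affine_add int_affine_diff row coord j left)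
  next
    case False
    then show ?thesis
      by (simp only: gc_row.simps row_step_def if_False)
        (intro int_affine_add int_affine_diff row coord j right)
  qed
qed

lemma finite_gc_index: "finite (gc_index n)"
  by (rule finite_subset[of _ "{..n} \<times> {..n}"]) (auto simp: gc_index_def)

lemma int_affine_gc_coord:
  assumes "k \<in> {1..n}" "j \<in> {1..k}"
  shows "int_affine (gc_index n) (\<lambda>x. gc_coord \<sigma> (gcx n lam x) k j)"
proof -
  have "int_affine (gc_index n) (\<lambda>x. gcx n lam x k i)" if "k \<in> {1..Suc n}" "i \<in> {1..k}" for k i
  proof (cases "k = n + 1")
    case True
    then show ?thesis
      using int_affine_const[of "gc_index n" "\<Sum>l\<in>{i..n}. int (lam l)"] by (simp add: gcx_def)
  next
    case False
    then have "(k, i) \<in> gc_index n"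
      using that by (auto simp: gc_index_def)
    with False show ?thesis
      by (simp add: gcx_def int_affine_coord finite_gc_index)
  qed
  note gcx = this
  show ?thesis
    using assms unfolding gc_coord_def
    by (cases "\<sigma> k") (auto intro!: int_affine_sum int_affine_diff gcx)
qed

text \<open>\<open>F\<close> builds the rows below the top row given by \<open>lam\<close>, and
  \<open>G\<close> reads the block coordinates back from the rows. The chart property matches the
  two systems of inequalities.\<close>

lemma unimod_equiv_of_gc_chart:
  assumes w: "length w = Nn n" "set w \<subseteq> {1..n}" and chart: "gc_chart \<sigma> n w \<pi>"
  shows "unimod_equiv {1..Nn n} (gc_index n) (string_polytope n w lam) (GC n lam)"
proof -
  let ?I = "{1..Nn n}" and ?J = "gc_index n"
  \<comment> \<open>The fixed top row; its integrality makes the translation part of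
    \<open>F\<close> integral.\<close>
  define r where "r j = (\<Sum>l\<in>{j..n}. int (lam l))" for j
  define F where "F t p = gc_row \<sigma> n (\<lambda>k j. t (\<pi> (k, j))) (\<lambda>j. real_of_int (r j)) (Suc n - fst p) (snd p)"
    for t :: "nat \<Rightarrow> real" and p
  define G where "G x i = (case inv_into ?J \<pi> i of (k, j) \<Rightarrow> gc_coord \<sigma> (gcx n lam x) k j)" for x i
  have bij: "bij_betw \<pi> ?J ?I"
    using chart w by (simp add: gc_chart_def)
  then have inj: "inj_on \<pi> ?J" and img: "\<pi> ` ?J = ?I"
    by (auto simp: bij_betw_def)
  \<comment> \<open>\<open>F\<close> is defined at \<open>(n + 1, j)\<close> as well, where it
    returns the fixed top row, in agreement with the convention in \<open>gcx\<close>.\<close>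
  have gcx_F: "gcx n lam (F t) = (\<lambda>k j. F t (k, j))" for t
    by (auto simp: gcx_def F_def r_def fun_eq_iff)
  have rows_F: "rows \<sigma> n (\<lambda>k j. t (\<pi> (k, j))) (\<lambda>k j. F t (k, j))" for t
    using rows_gc_row by (simp add: F_def)
  have G_\<pi>: "G x (\<pi> (k, j)) = gc_coord \<sigma> (gcx n lam x) k j" if "(k, j) \<in> ?J" for x k j
    using that inj by (simp add: G_def)
  have mem: "(k, j) \<in> ?J \<longleftrightarrow> k \<in> {1..n} \<and> j \<in> {1..k}" for k j
    by (auto simp: gc_index_def)
  define p where "p t \<longleftrightarrow> string_ineqs n w t \<and> lam_ineqs w (\<lambda>i. real (lam i)) t" for t
  define q where "q x \<longleftrightarrow> interlacing n (gcx n lam x)" for x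
  have "unimod_equiv ?I ?J {t. (\<forall>a. a \<notin> ?I \<longrightarrow> t a = 0) \<and> p t} {x. (\<forall>b. b \<notin> ?J \<longrightarrow> x b = 0) \<and> q x}"
  proof (rule unimod_equivI[where F = F and G = G])
    show "finite ?I" "finite ?J"
      by (simp_all add: finite_gc_index)
    show "int_affine ?I (\<lambda>t. F t b)" if "b \<in> ?J" for b
      unfolding F_def using that img by (intro int_affine_gc_row) (auto simp: gc_index_def)
    show "int_affine ?J (\<lambda>x. G x i)" if "i \<in> ?I" for i
    proof -
      obtain k j where kj: "(k, j) \<in> ?J" "i = \<pi> (k, j)"
        using \<open>i \<in> ?I\<close> unfolding img[symmetric] by auto
      then show ?thesis
        by (simp only: G_\<pi> mem int_affine_gc_coord)
    qed
    show "G (F t) i = t i" if "i \<in> ?I" for t i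
    proof -
      obtain k j where kj: "(k, j) \<in> ?J" "i = \<pi> (k, j)"
        using \<open>i \<in> ?I\<close> unfolding img[symmetric] by auto
      then show ?thesis
        using gc_coord_rows[OF rows_F[of t]] by (simp only: G_\<pi> gcx_F mem)
    qed
    show "F (G x) b = x b" if "b \<in> ?J" for x b
    proof -
      obtain k j where kj: "b = (k, j)" "k \<in> {1..n}" "j \<in> {1..k}"
        using \<open>b \<in> ?J\<close> by (cases b) (auto simp: gc_index_def)
      have rows_G: "rows \<sigma> n (\<lambda>k j. G x (\<pi> (k, j))) (gcx n lam x)"
        using rows_gc_coord[of \<sigma> n "gcx n lam x"]
        by (subst rows_cong[where a' = "gc_coord \<sigma> (gcx n lam x)"]) (simp_all only: G_\<pi> mem simp_thms)
      have "F (G x) (k, j) = gcx n lam x k j"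
      proof (rule rows_unique[OF rows_F rows_G])
        show "F (G x) (Suc n, j) = gcx n lam x (Suc n) j" for j
          by (simp add: gcx_def F_def r_def)
      qed (use kj in auto)
      then show ?thesis
        using kj by (simp add: gcx_def)
    qed
    show "p t \<longleftrightarrow> q (\<lambda>b. if b \<in> ?J then F t b else 0)" for t
    proof -
      let ?X = "\<lambda>k j. F t (k, j)"
      have "lam_ineqs w (\<lambda>i. real (lam i)) t \<longleftrightarrow> lam_ineqs w (\<lambda>i. ?X (Suc n) i - ?X (Suc n) (Suc i)) t"
      proof (rule lam_ineqs_cong)
        fix i assume "i \<in> set w"
        \<comment> \<open>\<open>lam i\<close> is the gap between consecutive entries of the top
          row, whose last entry is the empty sum.\<close>
        then have "{i..n} = insert i {Suc i..n}"
          using w by auto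
        then show "real (lam i) = ?X (Suc n) i - ?X (Suc n) (Suc i)"
          by (simp add: F_def r_def)
      qed
      then have "p t \<longleftrightarrow> interlacing n ?X"
        using chart rows_F[of t] unfolding gc_chart_def p_def by blast
      also have "\<dots> \<longleftrightarrow> q (\<lambda>b. if b \<in> ?J then F t b else 0)"
        unfolding q_def by (rule interlacing_cong) (auto simp: gcx_def F_def r_def gc_index_def)
      finally show ?thesis .
    qed
  qed
  moreover have "string_polytope n w lam = {t. (\<forall>a. a \<notin> ?I \<longrightarrow> t a = 0) \<and> p t}"
    by (simp add: string_polytope_def p_def string_ineqs_def lam_ineqs_def w(1))
  moreover have "GC n lam = {x. (\<forall>b. b \<notin> ?J \<longrightarrow> x b = 0) \<and> q x}"
    by (auto simp: GC_def q_def interlacing_def)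
  ultimately show ?thesis
    by simp
qed

theorem mainTheorem15:
  fixes n :: nat and w :: "nat list"
  assumes "n \<ge> 1"
    and "red_w0 n w"
    and "\<exists>\<sigma> :: nat \<Rightarrow> AD. \<forall>k\<in>{1..n}. ind (\<sigma> k) k (iter_contr \<sigma> n w (n - k)) = 0"
  shows "\<forall>lam :: nat \<Rightarrow> nat.
           unimod_equiv {1..Nn n} (gc_index n) (string_polytope n w lam) (GC n lam)"
proof -
  \<comment> \<open>The chart is obtained before any weight is fixed, so one choice serves every
    \<open>lam\<close>.\<close>
  obtain \<sigma> \<pi> where "gc_chart \<sigma> n w \<pi>"
    using ex_gc_chart assms(2,3) by blast
  then show ?thesis
    using unimod_equiv_of_gc_chart assms(2) by (simp add: red_w0_def)
qed

end
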